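(* Let $\mathbb F$ be an algebraically closed field of characteristic zero. Suppose that the nilpotent element $e\in\mathfrak g=\mathfrak{gl}_{n+m}(\mathbb F)$ is defined by the partition $(n,m)$ with $n\ge m$ (two Jordan blocks, of sizes $n$ and $m$). Then the null-cone $\mathcal N(e)\subset\mathfrak g_e^*$ has $\min(n-m,m)+1$ irreducible components.
   Context: $\mathfrak g_e$ is the centraliser of $e$ in $\mathfrak g$, $G_e$ the stabiliser of $e$ in $G=GL_{n+m}(\mathbb F)$. The null-cone $\mathcal N(e)$ is the fibre through $0$ of the quotient morphism $\mathfrak g_e^*\to\mathrm{Spec}\,\mathcal S(\mathfrak g_e)^{G_e}$, i.e. the set of common zeros in $\mathfrak g_e^*$ of all homogeneous elements of positive degree of $\mathcal S(\mathfrak g_e)^{G_e}=\mathcal S(\mathfrak g_e)^{\mathfrak g_e}$, where $\mathcal S(\mathfrak g_e)=\mathbb F[\mathfrak g_e^*]$ is the symmetric algebra. *)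

theory Defs
  imports
    "HOL-Analysis.Abstract_Topology"
    "HOL-Computational_Algebra.Polynomial_Factorial"
    "Jordan_Normal_Form.Jordan_Normal_Form"
begin

section \<open>Polynomial functions on the dual of a space of matrices\<close>

text \<open>
  Throughout, \<open>V\<close> is a linear subspace of the \<open>N \<times> N\<close> matrices.  Functionals on \<open>V\<close>, and
  polynomial functions on the dual of \<open>V\<close>, are represented by \<^const>\<open>extensional\<close> functions, so
  that equality in HOL is equality of functions on \<open>V\<close> (on the dual of \<open>V\<close>, respectively).
\<close>

definition dual_space :: "'a::field mat set \<Rightarrow> ('a mat \<Rightarrow> 'a) set" where
  "dual_space V = {\<xi> \<in> extensional V.
     (\<forall>x\<in>V. \<forall>y\<in>V. \<xi> (x + y) = \<xi> x + \<xi> y) \<and> (\<forall>c. \<forall>x\<in>V. \<xi> (c \<cdot>\<^sub>m x) = c * \<xi> x)}"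

text \<open>
  The symmetric algebra of \<open>V\<close> is realised as the algebra of polynomial functions on the dual
  of \<open>V\<close> (faithful, since the base field will be infinite): the algebra of functions generated
  by the constants and the evaluations \<open>\<xi> \<mapsto> \<xi> x\<close> with \<open>x \<in> V\<close>.
\<close>

inductive_set sym_alg :: "'a::field mat set \<Rightarrow> (('a mat \<Rightarrow> 'a) \<Rightarrow> 'a) set"
  for V :: "'a mat set" where
  sym_alg_const: "(\<lambda>\<xi>\<in>dual_space V. c) \<in> sym_alg V"
| sym_alg_eval: "x \<in> V \<Longrightarrow> (\<lambda>\<xi>\<in>dual_space V. \<xi> x) \<in> sym_alg V"
| sym_alg_add: "p \<in> sym_alg V \<Longrightarrow> q \<in> sym_alg V \<Longrightarrow> (\<lambda>\<xi>\<in>dual_space V. p \<xi> + q \<xi>) \<in> sym_alg V"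
| sym_alg_mult: "p \<in> sym_alg V \<Longrightarrow> q \<in> sym_alg V \<Longrightarrow> (\<lambda>\<xi>\<in>dual_space V. p \<xi> * q \<xi>) \<in> sym_alg V"

text \<open>The homogeneous component of degree \<open>d\<close>: sums of products of \<open>d\<close> elements of \<open>V\<close> and a scalar.\<close>

inductive homogeneous :: "'a::field mat set \<Rightarrow> nat \<Rightarrow> (('a mat \<Rightarrow> 'a) \<Rightarrow> 'a) \<Rightarrow> bool"
  for V :: "'a mat set" where
  homogeneous_const: "homogeneous V 0 (\<lambda>\<xi>\<in>dual_space V. c)"
| homogeneous_zero: "homogeneous V d (\<lambda>\<xi>\<in>dual_space V. 0)"
| homogeneous_mult: "x \<in> V \<Longrightarrow> homogeneous V d p \<Longrightarrow> homogeneous V (Suc d) (\<lambda>\<xi>\<in>dual_space V. \<xi> x * p \<xi>)"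
| homogeneous_add: "homogeneous V d p \<Longrightarrow> homogeneous V d q \<Longrightarrow> homogeneous V d (\<lambda>\<xi>\<in>dual_space V. p \<xi> + q \<xi>)"

section \<open>Zariski topology and irreducible components\<close>

definition zariski :: "'a::field mat set \<Rightarrow> ('a mat \<Rightarrow> 'a) topology" where
  "zariski V = topology (\<lambda>U. \<exists>A\<subseteq>sym_alg V. U = {\<xi> \<in> dual_space V. \<exists>p\<in>A. p \<xi> \<noteq> 0})"

lemma istopology_zariski:
  "istopology (\<lambda>U. \<exists>A\<subseteq>sym_alg V. U = {\<xi> \<in> dual_space V. \<exists>p\<in>A. p \<xi> \<noteq> (0::'a::field)})"
  (is "istopology ?P")
  unfolding istopology_def
proof (intro conjI allI impI)
  fix S T assume "?P S" "?P T"
  from \<open>?P S\<close> obtain A where A: "A \<subseteq> sym_alg V" "S = {\<xi> \<in> dual_space V. \<exists>p\<in>A. p \<xi> \<noteq> 0}"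
    by (elim exE conjE)
  from \<open>?P T\<close> obtain B where B: "B \<subseteq> sym_alg V" "T = {\<xi> \<in> dual_space V. \<exists>p\<in>B. p \<xi> \<noteq> 0}"
    by (elim exE conjE)
  let ?C = "(\<lambda>(p, q). \<lambda>\<xi>\<in>dual_space V. p \<xi> * q \<xi>) ` (A \<times> B)"
  have "?C \<subseteq> sym_alg V" using A(1) B(1) by (auto intro!: sym_alg_mult)
  moreover have "S \<inter> T = {\<xi> \<in> dual_space V. \<exists>p\<in>?C. p \<xi> \<noteq> 0}"
    unfolding A(2) B(2) by (auto simp: set_eq_iff)
  ultimately show "?P (S \<inter> T)" by (intro exI[of _ ?C] conjI)
next
  fix K assume K: "\<forall>S\<in>K. ?P S"
  let ?B = "{p \<in> sym_alg V. \<forall>\<xi>\<in>dual_space V. p \<xi> \<noteq> 0 \<longrightarrow> \<xi> \<in> \<Union>K}"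
  have "\<Union>K = {\<xi> \<in> dual_space V. \<exists>p\<in>?B. p \<xi> \<noteq> 0}"
  proof (rule equalityI; rule subsetI)
    fix \<xi> assume "\<xi> \<in> \<Union>K"
    then obtain S where S: "S \<in> K" "\<xi> \<in> S" by (rule UnionE)
    from K S(1) have "?P S" by (rule bspec)
    then obtain A where A: "A \<subseteq> sym_alg V" and S_eq: "S = {\<xi> \<in> dual_space V. \<exists>p\<in>A. p \<xi> \<noteq> 0}"
      by (elim exE conjE)
    have "\<xi> \<in> dual_space V \<and> (\<exists>p\<in>A. p \<xi> \<noteq> 0)" using S(2) unfolding S_eq by (rule CollectD)
    then obtain p where p: "\<xi> \<in> dual_space V" "p \<in> A" "p \<xi> \<noteq> 0" by (elim conjE bexE)
    have "\<zeta> \<in> \<Union>K" if "\<zeta> \<in> dual_space V" "p \<zeta> \<noteq> 0" for \<zeta>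
    proof (rule UnionI[OF S(1)])
      show "\<zeta> \<in> S" unfolding S_eq using that p(2) by auto
    qed
    then have "p \<in> ?B" using A p(2) by auto
    then show "\<xi> \<in> {\<xi> \<in> dual_space V. \<exists>p\<in>?B. p \<xi> \<noteq> 0}" using p(1,3) by auto
  qed auto
  moreover have "?B \<subseteq> sym_alg V" by auto
  ultimately show "?P (\<Union>K)" by (intro exI[of _ ?B] conjI)
qed

lemma openin_zariski:
  "openin (zariski V) U \<longleftrightarrow> (\<exists>A\<subseteq>sym_alg V. U = {\<xi> \<in> dual_space V. \<exists>p\<in>A. p \<xi> \<noteq> 0})"
  unfolding zariski_def by (simp add: topology_inverse' istopology_zariski)

lemma topspace_zariski [simp]: "topspace (zariski V) = dual_space V"
proof -
  have "openin (zariski V) (dual_space V)"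
    unfolding openin_zariski
    by (rule exI[of _ "{\<lambda>\<xi>\<in>dual_space V. 1}"]) (auto intro: sym_alg_const)
  moreover have "topspace (zariski V) \<subseteq> dual_space V"
    using openin_topspace[of "zariski V"] unfolding openin_zariski by (elim exE conjE) auto
  ultimately show ?thesis by (intro equalityI openin_subset)
qed

lemma closedin_zariski:
  "closedin (zariski V) C \<longleftrightarrow> (\<exists>A\<subseteq>sym_alg V. C = {\<xi> \<in> dual_space V. \<forall>p\<in>A. p \<xi> = 0})"
proof -
  have "closedin (zariski V) C \<longleftrightarrow> C \<subseteq> dual_space V \<and>
      (\<exists>A\<subseteq>sym_alg V. dual_space V - C = {\<xi> \<in> dual_space V. \<exists>p\<in>A. p \<xi> \<noteq> 0})"
    by (simp add: closedin_def openin_zariski)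
  also have "\<dots> \<longleftrightarrow> (\<exists>A\<subseteq>sym_alg V. C = {\<xi> \<in> dual_space V. \<forall>p\<in>A. p \<xi> = 0})"
  proof -
    have "C \<subseteq> dual_space V \<and> dual_space V - C = {\<xi> \<in> dual_space V. \<exists>p\<in>A. p \<xi> \<noteq> 0} \<longleftrightarrow>
        C = {\<xi> \<in> dual_space V. \<forall>p\<in>A. p \<xi> = 0}" for A
      by (auto simp: set_eq_iff)
    note eq = this
    show ?thesis unfolding eq[symmetric] by iprover
  qed
  finally show ?thesis .
qed

definition irreducible_in :: "'b topology \<Rightarrow> 'b set \<Rightarrow> bool" where
  "irreducible_in X S \<longleftrightarrow> S \<subseteq> topspace X \<and> S \<noteq> {} \<and>
     (\<forall>C D. closedin X C \<longrightarrow> closedin X D \<longrightarrow> S \<subseteq> C \<union> D \<longrightarrow> S \<subseteq> C \<or> S \<subseteq> D)"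

definition irreducible_components :: "'b topology \<Rightarrow> 'b set \<Rightarrow> 'b set set" where
  "irreducible_components X S =
     {Z. irreducible_in X Z \<and> Z \<subseteq> S \<and> (\<forall>Z'. irreducible_in X Z' \<longrightarrow> Z' \<subseteq> S \<longrightarrow> Z \<subseteq> Z' \<longrightarrow> Z' = Z)}"

section \<open>Centralisers, stabilisers and the null-cone\<close>

text \<open>Here \<open>e\<close> is a square matrix, and the ambient Lie algebra consists of all matrices of its size.\<close>

definition centraliser :: "'a::field mat \<Rightarrow> 'a mat set" where
  "centraliser e = {x \<in> carrier_mat (dim_row e) (dim_row e). x * e - e * x = 0\<^sub>m (dim_row e) (dim_row e)}"

definition stabiliser :: "'a::field mat \<Rightarrow> 'a mat set" where
  "stabiliser e = (let R = ring_mat TYPE('a) (dim_row e) () in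
     {g \<in> Units R. g * e * inv\<^bsub>R\<^esub> g = e})"

text \<open>The coadjoint action \<open>(g \<cdot> \<xi>) x = \<xi> (g\<^sup>-\<^sup>1 x g)\<close> of the stabiliser on the dual of the centraliser.\<close>

definition coadj :: "'a::field mat \<Rightarrow> 'a mat \<Rightarrow> ('a mat \<Rightarrow> 'a) \<Rightarrow> ('a mat \<Rightarrow> 'a)" where
  "coadj e g \<xi> = (\<lambda>x\<in>centraliser e. \<xi> (inv\<^bsub>ring_mat TYPE('a) (dim_row e) ()\<^esub> g * x * g))"

definition sym_invariants :: "'a::field mat \<Rightarrow> (('a mat \<Rightarrow> 'a) \<Rightarrow> 'a) set" where
  "sym_invariants e = {p \<in> sym_alg (centraliser e).
     \<forall>g\<in>stabiliser e. \<forall>\<xi>\<in>dual_space (centraliser e). p (coadj e g \<xi>) = p \<xi>}"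

definition null_cone :: "'a::field mat \<Rightarrow> ('a mat \<Rightarrow> 'a) set" where
  "null_cone e = {\<xi> \<in> dual_space (centraliser e).
     \<forall>p\<in>sym_invariants e. \<forall>d>0. homogeneous (centraliser e) d p \<longrightarrow> p \<xi> = 0}"

end

theory Submission
  imports Defs
begin

text \<open>
  Put \<open>r = n - m\<close>. The centraliser of \<open>e\<close> consists of the matrices \<open>(a, b; t\<^sup>r c, d)\<close> over \<open>F[t]\<close>, with
  \<open>a\<close> modulo \<open>t\<^sup>n\<close> and \<open>b\<close>, \<open>c\<close>, \<open>d\<close> modulo \<open>t\<^sup>m\<close>. A functional on it is the residue trace form against
  a matrix \<open>\<Xi> = (A, B; t\<^sup>r C, t\<^sup>r D)\<close>, on which the stabiliser acts by conjugation. The coefficients of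
  \<open>A + t\<^sup>r D\<close> modulo \<open>t\<^sup>n\<close> and of \<open>A D - B C\<close> modulo \<open>t\<^sup>m\<close> are invariant. If \<open>B\<close> is a unit, then \<open>\<Xi>\<close> is
  conjugate to a point with \<open>B = 1\<close> and \<open>D = 0\<close> that is determined by these coefficients; hence by
  density every invariant is a function of them, and the null-cone is given by \<open>A = - t\<^sup>r D\<close> and
  \<open>B C + t\<^sup>r D\<^sup>2 = 0\<close> modulo \<open>t\<^sup>m\<close>.

  The points with \<open>B = t\<^sup>a \<mu>\<close>, \<open>D = \<mu> \<eta>\<close>, \<open>C = t\<^sup>m\<^sup>-\<^sup>a w - t\<^sup>r\<^sup>-\<^sup>a \<mu> \<eta>\<^sup>2\<close>, for \<open>0 \<le> a \<le> min r m\<close>, form irreducible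
  subsets, and the vanishing orders of \<open>B\<close> and \<open>C\<close> show that no two closures are comparable. They contain
  all points at which the order of \<open>B\<close> is at most \<open>r\<close>. Every other point is the limit of a curve in
  the null-cone along which \<open>B\<close> has generically smaller order, so the closures cover the null-cone.
  Since any two points of a piece lie on a polynomial curve, irreducibility and limits only involve
  polynomials in one variable.
\<close>

section \<open>The centraliser of a nilpotent matrix with two Jordan blocks\<close>

text \<open>A matrix product sums over a block of fixed length, a product of polynomials over
  \<open>k \<le> j\<close>. Terms with \<open>k > j\<close> vanish because of the shift, and the
  hypothesis removes those with \<open>N \<le> k \<le> j\<close>.\<close>

lemma sum_coeff_monom_mult:
  fixes p q :: "'a::comm_semiring_1 poly"
  assumes "\<And>k. N \<le> k \<Longrightarrow> k \<le> j \<Longrightarrow> coeff q (j - k) = 0"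
  shows "(\<Sum>k<N. coeff p k * coeff (monom 1 k * q) j) = coeff (p * q) j"
proof -
  have "(\<Sum>k<N. coeff p k * coeff (monom 1 k * q) j) =
      (\<Sum>k\<in>{..<N} \<union> {..j}. coeff p k * coeff (monom 1 k * q) j)"
    by (rule sum.mono_neutral_left) (use assms in \<open>auto simp: coeff_monom_mult not_less\<close>)
  also have "\<dots> = (\<Sum>k\<le>j. coeff p k * coeff q (j - k))"
    by (rule sum.mono_neutral_cong_right) (auto simp: coeff_monom_mult not_less)
  finally show ?thesis by (simp add: coeff_mult)
qed

lemma coeff_sum_monom:
  "coeff (\<Sum>k<N. monom (f k) k) i = (if i < N then f i else 0)"
  by (simp add: coeff_sum if_distrib sum.delta' cong: if_cong)

text \<open>A row vector is read as an element of \<open>F[t]/t\<^sup>n \<times> F[t]/t\<^sup>m\<close>; \<open>top_poly n i\<close> and \<open>bot_poly n i\<close> are the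
  components of the \<open>i\<close>-th basis vector, and \<open>toeplitz\<close> is right multiplication by \<open>(a, b; t\<^sup>n\<^sup>-\<^sup>m c, d)\<close>.\<close>

definition top_poly :: "nat \<Rightarrow> nat \<Rightarrow> 'a::field poly" where
  "top_poly n i = (if i < n then monom 1 i else 0)"

definition bot_poly :: "nat \<Rightarrow> nat \<Rightarrow> 'a::field poly" where
  "bot_poly n i = (if i < n then 0 else monom 1 (i - n))"

definition toeplitz :: "nat \<Rightarrow> nat \<Rightarrow> 'a::field poly \<Rightarrow> 'a poly \<Rightarrow> 'a poly \<Rightarrow> 'a poly \<Rightarrow> 'a mat" where
  "toeplitz n m a b c d = mat (n + m) (n + m) (\<lambda>(i, j).
     if j < n then coeff (top_poly n i * a + bot_poly n i * (monom 1 (n - m) * c)) j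
     else coeff (top_poly n i * b + bot_poly n i * d) (j - n))"

lemma toeplitz_carrier [simp]: "toeplitz n m a b c d \<in> carrier_mat (n + m) (n + m)"
  by (simp add: toeplitz_def)

lemma toeplitz_dim [simp]: "dim_row (toeplitz n m a b c d) = n + m" "dim_col (toeplitz n m a b c d) = n + m"
  by (simp_all add: toeplitz_def)

lemma toeplitz_index:
  assumes "i < n + m" "j < n + m"
  shows "toeplitz n m a b c d $$ (i, j) =
    (if j < n then coeff (top_poly n i * a + bot_poly n i * (monom 1 (n - m) * c)) j
     else coeff (top_poly n i * b + bot_poly n i * d) (j - n))"
  using assms by (simp add: toeplitz_def)

lemma sum_split_nm: "(\<Sum>k=0..<n+m. f k) = (\<Sum>k<n. f k) + (\<Sum>k<m. f (n + k))"
  for f :: "nat \<Rightarrow> 'b::comm_monoid_add"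
proof -
  have "(\<Sum>k=0..<n+m. f k) = (\<Sum>k=0..<n. f k) + (\<Sum>k=n..<n+m. f k)"
    by (simp add: sum.atLeastLessThan_concat)
  also have "(\<Sum>k=n..<n+m. f k) = (\<Sum>k<m. f (n + k))"
    using sum.shift_bounds_nat_ivl[of f 0 n m] by (simp add: atLeast0LessThan add.commute)
  finally show ?thesis by (simp add: atLeast0LessThan)
qed

text \<open>Each row is a pair of truncated polynomials. The lost coefficients do not matter: the
  factor \<open>t^(n-m)\<close> of the lower left entry turns congruences modulo \<open>t^m\<close>
  into congruences modulo \<open>t^n\<close>, and \<open>m \<le> n\<close> lets classes modulo
  \<open>t^n\<close> act modulo \<open>t^m\<close>.\<close>

lemma toeplitz_mult:
  assumes "m \<le> n"
  shows "toeplitz n m a b c d * toeplitz n m a' b' c' d' =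
    toeplitz n m (a * a' + monom 1 (n - m) * (b * c')) (a * b' + b * d')
      (c * a' + d * c') (monom 1 (n - m) * (c * b') + d * d')" (is "?X * ?Y = ?Z")
proof (rule eq_matI)
  fix i j assume "i < dim_row ?Z" "j < dim_col ?Z"
  then have i: "i < n + m" and j: "j < n + m" by simp_all
  \<comment> \<open>\<open>P\<close> and \<open>Q\<close> are the two components of row
    \<open>i\<close> of the left factor.\<close>
  define P where "P = top_poly n i * a + bot_poly n i * (monom 1 (n - m) * c)"
  define Q where "Q = top_poly n i * b + bot_poly n i * d"
  have "(?X * ?Y) $$ (i, j) = (\<Sum>k=0..<n+m. ?X $$ (i, k) * ?Y $$ (k, j))"
    using i j by (simp add: scalar_prod_def)
  also have "\<dots> = (\<Sum>k<n. coeff P k * ?Y $$ (k, j)) + (\<Sum>k<m. coeff Q k * ?Y $$ (n + k, j))"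
    using i by (simp add: sum_split_nm toeplitz_index P_def Q_def)
  also have "\<dots> = ?Z $$ (i, j)"
  proof (cases "j < n")
    case True
    have 1: "(\<Sum>k<n. coeff P k * ?Y $$ (k, j)) = (\<Sum>k<n. coeff P k * coeff (monom 1 k * a') j)"
      using True by (intro sum.cong) (auto simp: toeplitz_index top_poly_def bot_poly_def)
    have 2: "(\<Sum>k<m. coeff Q k * ?Y $$ (n + k, j)) =
        (\<Sum>k<m. coeff Q k * coeff (monom 1 k * (monom 1 (n - m) * c')) j)"
      using True by (intro sum.cong) (auto simp: toeplitz_index top_poly_def bot_poly_def)
    have 3: "(\<Sum>k<n. coeff P k * coeff (monom 1 k * a') j) = coeff (P * a') j"
      by (rule sum_coeff_monom_mult) (use True in auto)
    have 4: "(\<Sum>k<m. coeff Q k * coeff (monom 1 k * (monom 1 (n - m) * c')) j)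
        = coeff (Q * (monom 1 (n - m) * c')) j"
      by (rule sum_coeff_monom_mult) (use True assms in \<open>auto simp: coeff_monom_mult\<close>)
    show ?thesis
      unfolding 1 2 3 4 coeff_add[symmetric]
      using True i j by (simp add: toeplitz_index P_def Q_def algebra_simps)
  next
    case False
    have 1: "(\<Sum>k<n. coeff P k * ?Y $$ (k, j)) = (\<Sum>k<n. coeff P k * coeff (monom 1 k * b') (j - n))"
      using False j by (intro sum.cong) (auto simp: toeplitz_index top_poly_def bot_poly_def)
    have 2: "(\<Sum>k<m. coeff Q k * ?Y $$ (n + k, j)) = (\<Sum>k<m. coeff Q k * coeff (monom 1 k * d') (j - n))"
      using False j by (intro sum.cong) (auto simp: toeplitz_index top_poly_def bot_poly_def)
    have 3: "(\<Sum>k<n. coeff P k * coeff (monom 1 k * b') (j - n)) = coeff (P * b') (j - n)"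
      by (rule sum_coeff_monom_mult) (use False j assms in auto)
    have 4: "(\<Sum>k<m. coeff Q k * coeff (monom 1 k * d') (j - n)) = coeff (Q * d') (j - n)"
      by (rule sum_coeff_monom_mult) (use False j in auto)
    show ?thesis
      unfolding 1 2 3 4 coeff_add[symmetric]
      using False i j by (simp add: toeplitz_index P_def Q_def algebra_simps)
  qed
  finally show "(?X * ?Y) $$ (i, j) = ?Z $$ (i, j)" .
qed simp_all

lemma toeplitz_add:
  "toeplitz n m a b c d + toeplitz n m a' b' c' d' = toeplitz n m (a + a') (b + b') (c + c') (d + d')"
  by (rule eq_matI) (simp_all add: toeplitz_index algebra_simps)

lemma toeplitz_smult: "k \<cdot>\<^sub>m toeplitz n m a b c d = toeplitz n m ([:k:] * a) ([:k:] * b) ([:k:] * c) ([:k:] * d)"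
  by (rule eq_matI) (simp_all add: toeplitz_index algebra_simps)

lemma toeplitz_one: "toeplitz n m 1 0 0 1 = 1\<^sub>m (n + m)"
  by (rule eq_matI) (auto simp: toeplitz_index top_poly_def bot_poly_def)

lemma toeplitz_eq_0_iff:
  assumes "0 < m" "m \<le> n"
  shows "toeplitz n m a b c d = 0\<^sub>m (n + m) (n + m) \<longleftrightarrow>
    monom 1 n dvd a \<and> monom 1 m dvd b \<and> monom 1 m dvd c \<and> monom 1 m dvd d" (is "?L \<longleftrightarrow> ?R")
proof
  assume ?L
  then have *: "toeplitz n m a b c d $$ (i, j) = 0" if "i < n + m" "j < n + m" for i j
    using that by simp
  have "coeff a k = 0" if "k < n" for k
    using *[of 0 k] that assms by (simp add: toeplitz_index top_poly_def bot_poly_def flip: one_pCons add: monom_0)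
  moreover have "coeff b k = 0" if "k < m" for k
    using *[of 0 "n + k"] that assms by (simp add: toeplitz_index top_poly_def bot_poly_def flip: one_pCons add: monom_0)
  moreover have "coeff c k = 0" if "k < m" for k
  proof -
    \<comment> \<open>The column is shifted to undo the factor \<open>t^(n-m)\<close> in front of
      \<open>c\<close>.\<close>
    obtain l where l: "l = k + (n - m)" by simp
    then have "l < n" "\<not> l < n - m" "l - (n - m) = k" using that assms by auto
    then show ?thesis
      using *[of n l] assms by (simp add: toeplitz_index top_poly_def bot_poly_def coeff_monom_mult monom_0)
  qed
  moreover have "coeff d k = 0" if "k < m" for k
    using *[of n "n + k"] that assms by (simp add: toeplitz_index top_poly_def bot_poly_def flip: one_pCons add: monom_0)
  ultimately show ?R by (simp add: monom_1_dvd_iff')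
next
  assume ?R
  then have *: "\<And>k. k < n \<Longrightarrow> coeff a k = 0" "\<And>k. k < m \<Longrightarrow> coeff b k = 0"
    "\<And>k. k < m \<Longrightarrow> coeff c k = 0" "\<And>k. k < m \<Longrightarrow> coeff d k = 0"
    by (auto simp: monom_1_dvd_iff')
  show ?L
    by (rule eq_matI) (use assms in \<open>auto simp: toeplitz_index top_poly_def bot_poly_def coeff_monom_mult *\<close>)
qed

section \<open>Commutant of the Jordan matrix\<close>

lemma jordan_matrix_index:
  assumes "i < n + m" "j < n + m"
  shows "jordan_matrix [(n, 0), (m, 0)] $$ (i, j) = (if Suc i = j \<and> j \<noteq> n then 1 else 0)"
  using assms unfolding jordan_matrix_def by (auto simp: Let_def)

lemma jordan_matrix_eq_toeplitz:
  "jordan_matrix [(n, 0), (m, 0)] = toeplitz n m (monom 1 1) 0 0 (monom 1 1)"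
  by (rule eq_matI) (auto simp: jordan_matrix_index toeplitz_index top_poly_def bot_poly_def mult_monom)

text \<open>Comparing entries of the two products shows that within a block of rows each row is the
  preceding one shifted to the right, so rows \<open>0\<close> and \<open>n\<close> determine
  \<open>X\<close>. The last row yields the divisibility of the lower left entry.\<close>

lemma commute_imp_toeplitz:
  fixes X :: "'a::field mat"
  assumes m: "0 < m" "m \<le> n" and X: "X \<in> carrier_mat (n + m) (n + m)"
    and comm: "X * jordan_matrix [(n, 0), (m, 0)] = jordan_matrix [(n, 0), (m, 0)] * X"
  shows "\<exists>a b c d. X = toeplitz n m a b c d"
proof -
  let ?J = "jordan_matrix [(n, 0), (m, 0)] :: 'a mat"
  have J: "?J \<in> carrier_mat (n + m) (n + m)" using jordan_matrix_carrier[of "[(n, 0), (m, 0)]"] by simp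
  have XJ: "(X * ?J) $$ (i, j) = (if j = 0 \<or> j = n then 0 else X $$ (i, j - 1))"
    if "i < n + m" "j < n + m" for i j
  proof -
    have "(X * ?J) $$ (i, j) = (\<Sum>k=0..<n+m. X $$ (i, k) * ?J $$ (k, j))"
      using that X J by (simp add: scalar_prod_def)
    also have "\<dots> = (\<Sum>k=0..<n+m. if k = j - 1 then (if j = 0 \<or> j = n then 0 else X $$ (i, k)) else 0)"
      using that by (intro sum.cong refl) (auto simp: jordan_matrix_index)
    also have "\<dots> = (if j = 0 \<or> j = n then 0 else X $$ (i, j - 1))"
      using less_imp_diff_less[OF that(2), of 1] by (simp add: sum.delta)
    finally show ?thesis .
  qed
  have JX: "(?J * X) $$ (i, j) = (if Suc i = n \<or> Suc i = n + m then 0 else X $$ (Suc i, j))"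
    if "i < n + m" "j < n + m" for i j
  proof -
    have "(?J * X) $$ (i, j) = (\<Sum>k=0..<n+m. ?J $$ (i, k) * X $$ (k, j))"
      using that X J by (simp add: scalar_prod_def)
    also have "\<dots> = (\<Sum>k=0..<n+m. if k = Suc i then (if k = n then 0 else X $$ (k, j)) else 0)"
      using that by (intro sum.cong) (auto simp: jordan_matrix_index)
    also have "\<dots> = (if Suc i = n \<or> Suc i = n + m then 0 else X $$ (Suc i, j))"
      using that by (simp add: sum.delta)
    finally show ?thesis .
  qed
  have rec: "X $$ (Suc i, j) = (if j = 0 \<or> j = n then 0 else X $$ (i, j - 1))"
    if "Suc i < n + m" "Suc i \<noteq> n" "j < n + m" for i j
    using XJ[of i j] JX[of i j] that comm by auto
  have last: "X $$ (n + m - 1, j) = 0" if "Suc j < n" for j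
    using XJ[of "n + m - 1" "Suc j"] JX[of "n + m - 1" "Suc j"] that comm m by auto
  define a where "a = (\<Sum>k<n. monom (X $$ (0, k)) k)"
  define b where "b = (\<Sum>k<m. monom (X $$ (0, n + k)) k)"
  define c where "c = (\<Sum>k<n. monom (X $$ (n, k)) k)"
  define d where "d = (\<Sum>k<m. monom (X $$ (n, n + k)) k)"
  have ab: "X $$ (i, j) = (if j < n then coeff (monom 1 i * a) j else coeff (monom 1 i * b) (j - n))"
    if "i < n" "j < n + m" for i j
    using that
  proof (induction i arbitrary: j)
    case 0
    then show ?case by (auto simp: a_def b_def coeff_sum_monom monom_0 simp flip: one_pCons)
  next
    case (Suc i)
    then show ?case by (auto simp: rec coeff_monom_mult)
  qed
  have cd: "X $$ (n + i, j) = (if j < n then coeff (monom 1 i * c) j else coeff (monom 1 i * d) (j - n))"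
    if "i < m" "j < n + m" for i j
    using that
  proof (induction i arbitrary: j)
    case 0
    then show ?case by (auto simp: c_def d_def coeff_sum_monom monom_0 simp flip: one_pCons)
  next
    case (Suc i)
    then show ?case by (auto simp: rec coeff_monom_mult)
  qed
  \<comment> \<open>The last row is row \<open>n\<close> shifted by \<open>m - 1\<close>, and by
    \<open>last\<close> it vanishes in all columns before \<open>n - 1\<close>.\<close>
  have "coeff c k = 0" if "k < n - m" for k
  proof -
    obtain l where l: "l = m - 1 + k" by simp
    then have "Suc l < n" "\<not> l < m - 1" "l - (m - 1) = k" "n + (m - 1) = n + m - 1"
      using that m by auto
    then show ?thesis
      using last[of l] cd[of "m - 1" l] m by (simp add: coeff_monom_mult)
  qed
  then have "monom 1 (n - m) dvd c" by (simp add: monom_1_dvd_iff')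
  then obtain c' where c': "c = monom 1 (n - m) * c'" by (elim dvdE)
  have "X = toeplitz n m a b c' d"
  proof (rule eq_matI)
    fix i j assume "i < dim_row (toeplitz n m a b c' d)" "j < dim_col (toeplitz n m a b c' d)"
    then have ij: "i < n + m" "j < n + m" by auto
    show "X $$ (i, j) = toeplitz n m a b c' d $$ (i, j)"
      using ij ab[of i j] cd[of "i - n" j]
      by (cases "i < n") (auto simp: toeplitz_index top_poly_def bot_poly_def c')
  qed (use X in auto)
  then show ?thesis by blast
qed

section \<open>Functionals, curves and the coadjoint action\<close>

lemma centraliser_iff:
  assumes "e \<in> carrier_mat N N"
  shows "x \<in> centraliser e \<longleftrightarrow> x \<in> carrier_mat N N \<and> x * e = e * x"
proof -
  have "x * e - e * x = 0\<^sub>m N N \<longleftrightarrow> x * e = e * x" if x: "x \<in> carrier_mat N N"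
  proof
    assume *: "x * e - e * x = 0\<^sub>m N N"
    show "x * e = e * x"
    proof (rule eq_matI)
      fix i j assume "i < dim_row (e * x)" "j < dim_col (e * x)"
      then have ij: "i < N" "j < N" using assms x by auto
      then have "(x * e - e * x) $$ (i, j) = 0" unfolding * by simp
      then show "(x * e) $$ (i, j) = (e * x) $$ (i, j)"
        using ij assms x by (simp del: index_mult_mat(1))
    qed (use assms x in auto)
  next
    assume "x * e = e * x"
    then show "x * e - e * x = 0\<^sub>m N N"
      using assms x by (intro eq_matI) (auto simp del: index_mult_mat(1))
  qed
  then show ?thesis using assms by (auto simp: centraliser_def)
qed

text \<open>Self-duality of \<open>F[t]/t^N\<close> under the residue pairing: only the values of
  \<open>g\<close> at \<open>1, ..., t^(N-1)\<close> matter, and listing them in reverse order turns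
  their combination into a coefficient of a product.\<close>

lemma linear_functional_coeff:
  fixes g :: "'a::field poly \<Rightarrow> 'a"
  assumes add: "\<And>p q. g (p + q) = g p + g q" and smult: "\<And>k p. g ([:k:] * p) = k * g p"
    and zero: "\<And>p. monom 1 N dvd p \<Longrightarrow> g p = 0" and N: "0 < N"
  shows "g p = coeff ((\<Sum>i<N. monom (g (monom 1 (N - 1 - i))) i) * p) (N - 1)"
proof -
  let ?q = "\<Sum>k<N. monom (coeff p k) k"
  have g0: "g 0 = 0" using smult[of 0 0] by simp
  have gs: "g (\<Sum>i\<in>I. f i) = (\<Sum>i\<in>I. g (f i))" if "finite I" for I :: "nat set" and f
    using that by induction (simp_all add: g0 add)
  have "monom 1 N dvd p - ?q" by (simp add: monom_1_dvd_iff' coeff_sum_monom)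
  then have "g p = g ?q" using add[of "p - ?q" ?q] zero by simp
  also have "\<dots> = (\<Sum>k<N. coeff p k * g (monom 1 k))"
    using smult[of "coeff p _" "monom 1 _"] by (simp add: gs smult_monom)
  also have "\<dots> = (\<Sum>i<N. coeff p (N - 1 - i) * g (monom 1 (N - 1 - i)))"
    by (rule sum.reindex_bij_witness[of _ "\<lambda>i. N - 1 - i" "\<lambda>i. N - 1 - i"]) auto
  also have "\<dots> = (\<Sum>i\<le>N - 1. coeff (\<Sum>i<N. monom (g (monom 1 (N - 1 - i))) i) i * coeff p (N - 1 - i))"
    using N by (intro sum.cong) (auto simp: coeff_sum_monom)
  finally show ?thesis by (simp add: coeff_mult)
qed

lemma coeff_monom_dvd: "monom 1 N dvd p \<Longrightarrow> i < N \<Longrightarrow> coeff p i = 0" for p :: "'a::comm_semiring_1 poly"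
  by (auto simp: coeff_monom_mult elim!: dvdE)

text \<open>In \<open>F[\<tau>][t]\<close> the outer variable is \<open>t\<close> and the inner one is the parameter \<open>\<tau>\<close> of a curve.\<close>

definition lift_poly :: "'a::comm_ring_1 poly \<Rightarrow> 'a poly poly" where
  "lift_poly p = map_poly (\<lambda>c. [:c:]) p"

definition specialise :: "'a::comm_ring_1 \<Rightarrow> 'a poly poly \<Rightarrow> 'a poly" where
  "specialise \<tau> P = map_poly (\<lambda>c. poly c \<tau>) P"

lemma coeff_lift_poly [simp]: "coeff (lift_poly p) i = [:coeff p i:]"
  by (simp add: lift_poly_def coeff_map_poly)

lemma coeff_specialise [simp]: "coeff (specialise \<tau> P) i = poly (coeff P i) \<tau>"
  by (simp add: specialise_def coeff_map_poly)

lemma specialise_hom [simp]: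
  "specialise \<tau> (P + Q) = specialise \<tau> P + specialise \<tau> Q"
  "specialise \<tau> (P - Q) = specialise \<tau> P - specialise \<tau> Q"
  "specialise \<tau> (- P) = - specialise \<tau> P"
  "specialise \<tau> (P * Q) = specialise \<tau> P * specialise \<tau> Q"
  "specialise \<tau> (monom c i) = monom (poly c \<tau>) i"
  "specialise \<tau> [:c:] = [:poly c \<tau>:]"
  "specialise \<tau> (lift_poly p) = p"
  "specialise \<tau> 0 = 0" "specialise \<tau> 1 = 1"
  by (rule poly_eqI; simp add: coeff_mult poly_sum coeff_pCons split: nat.splits;
      simp add: poly_0_coeff_0 flip: monom_0)+

text \<open>The presentation of the centraliser by four polynomials is all that is kept of
  \<open>e\<close>, so that no conjugating matrix appears in the geometry.\<close>

locale jordan_pair =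
  fixes e :: "'a::field_char_0 mat" and n m :: nat
    and \<Phi> :: "'a poly \<Rightarrow> 'a poly \<Rightarrow> 'a poly \<Rightarrow> 'a poly \<Rightarrow> 'a mat"
  assumes m_pos: "0 < m" and m_le: "m \<le> n"
    and e_carrier: "e \<in> carrier_mat (n + m) (n + m)"
    and centraliser_eq: "centraliser e = {\<Phi> a b c d |a b c d. True}"
    and phi_mult: "\<Phi> a b c d * \<Phi> a' b' c' d' =
      \<Phi> (a * a' + monom 1 (n - m) * (b * c')) (a * b' + b * d')
        (c * a' + d * c') (monom 1 (n - m) * (c * b') + d * d')"
    and phi_add: "\<Phi> a b c d + \<Phi> a' b' c' d' = \<Phi> (a + a') (b + b') (c + c') (d + d')"
    and phi_smult: "k \<cdot>\<^sub>m \<Phi> a b c d = \<Phi> ([:k:] * a) ([:k:] * b) ([:k:] * c) ([:k:] * d)"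
    and phi_one: "\<Phi> 1 0 0 1 = 1\<^sub>m (n + m)"
    and phi_eq_0_iff: "\<Phi> a b c d = 0\<^sub>m (n + m) (n + m) \<longleftrightarrow>
      monom 1 n dvd a \<and> monom 1 m dvd b \<and> monom 1 m dvd c \<and> monom 1 m dvd d"
begin

abbreviation V :: "'a mat set" where "V \<equiv> centraliser e"
abbreviation T :: "'a poly" where "T \<equiv> monom 1 (n - m)"
abbreviation R :: "'a mat ring" where "R \<equiv> ring_mat TYPE('a) (n + m) ()"

lemma phi_in [simp]: "\<Phi> a b c d \<in> V"
  by (auto simp: centraliser_eq)

lemma phi_carrier [simp]: "\<Phi> a b c d \<in> carrier_mat (n + m) (n + m)"
  using phi_in centraliser_iff[OF e_carrier] by blast

lemma phi_dim [simp]: "dim_row (\<Phi> a b c d) = n + m" "dim_col (\<Phi> a b c d) = n + m"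
  using carrier_matD[OF phi_carrier[of a b c d]] by simp_all

lemma phi_comm: "\<Phi> a b c d * e = e * \<Phi> a b c d"
  using phi_in centraliser_iff[OF e_carrier] by blast

lemma phi_eq_iff: "\<Phi> a b c d = \<Phi> a' b' c' d' \<longleftrightarrow>
  monom 1 n dvd a - a' \<and> monom 1 m dvd b - b' \<and> monom 1 m dvd c - c' \<and> monom 1 m dvd d - d'"
proof -
  have sum: "\<Phi> a b c d = \<Phi> (a - a') (b - b') (c - c') (d - d') + \<Phi> a' b' c' d'"
    by (simp add: phi_add)
  have "\<Phi> a b c d = \<Phi> a' b' c' d' \<longleftrightarrow> \<Phi> (a - a') (b - b') (c - c') (d - d') = 0\<^sub>m (n + m) (n + m)"
  proof
    assume eq: "\<Phi> a b c d = \<Phi> a' b' c' d'"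
    have "\<Phi> (a - a') (b - b') (c - c') (d - d') = \<Phi> a b c d + (-1) \<cdot>\<^sub>m \<Phi> a' b' c' d'"
      unfolding phi_smult phi_add by simp
    also have "\<dots> = 0\<^sub>m (n + m) (n + m)"
      unfolding eq by (rule eq_matI) auto
    finally show "\<Phi> (a - a') (b - b') (c - c') (d - d') = 0\<^sub>m (n + m) (n + m)" .
  next
    assume "\<Phi> (a - a') (b - b') (c - c') (d - d') = 0\<^sub>m (n + m) (n + m)"
    then show "\<Phi> a b c d = \<Phi> a' b' c' d'" unfolding sum by simp
  qed
  then show ?thesis by (simp add: phi_eq_0_iff)
qed

text \<open>The coordinates of a functional are the coefficients of \<open>A\<close>, \<open>B\<close>, \<open>C\<close>, \<open>D\<close> in reverse order: the value
  at \<open>t\<^sup>i\<close> in the first diagonal block is the coefficient of \<open>t\<^sup>n\<^sup>-\<^sup>1\<^sup>-\<^sup>i\<close> in \<open>A\<close>. With this convention the pairing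
  is the coefficient of \<open>t\<^sup>n\<^sup>-\<^sup>1\<close> in the trace of \<open>(A, B; t\<^sup>r C, t\<^sup>r D) (a, b; t\<^sup>r c, d)\<close>.\<close>

definition pairing where
  "pairing A B C D a b c d = coeff (A * a + T * (B * c + C * b + D * d)) (n - 1)"

text \<open>A matrix determines its four polynomials only modulo \<open>t^n\<close> and
  \<open>t^m\<close>; by \<open>pairing_eq\<close> the choice of representatives does not affect the
  value.\<close>

definition functional :: "'a poly \<Rightarrow> 'a poly \<Rightarrow> 'a poly \<Rightarrow> 'a poly \<Rightarrow> ('a mat \<Rightarrow> 'a)" where
  "functional A B C D = (\<lambda>x\<in>V. SOME y. \<exists>a b c d. x = \<Phi> a b c d \<and> y = pairing A B C D a b c d)"

lemma T_monom: "T * monom 1 m = monom 1 n"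
  using m_le by (simp add: mult_monom)

lemma T_dvd: "monom 1 m dvd p \<Longrightarrow> monom 1 n dvd T * p"
  unfolding T_monom[symmetric] by (rule mult_dvd_mono) auto

text \<open>Since \<open>T\<close> carries multiples of \<open>t^m\<close> to multiples of
  \<open>t^n\<close>, every summand of the pairing changes by a multiple of \<open>t^n\<close>,
  which the coefficient of \<open>t^(n-1)\<close> does not see.\<close>

lemma pairing_eq:
  assumes "monom 1 n dvd a - a'" "monom 1 m dvd b - b'" "monom 1 m dvd c - c'" "monom 1 m dvd d - d'"
    "monom 1 n dvd A - A'" "monom 1 m dvd B - B'" "monom 1 m dvd C - C'" "monom 1 m dvd D - D'"
  shows "pairing A B C D a b c d = pairing A' B' C' D' a' b' c' d'"
proof -
  have *: "monom 1 N dvd p * q - p' * q'" if "monom 1 N dvd p - p'" "monom 1 N dvd q - q'"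
    for N and p q p' q' :: "'a poly"
  proof -
    have "p * q - p' * q' = (p - p') * q + p' * (q - q')" by (simp add: algebra_simps)
    then show ?thesis using that by (metis dvd_add dvd_mult dvd_mult2)
  qed
  have "monom 1 n dvd (A * a - A' * a') + T * ((B * c - B' * c') + (C * b - C' * b') + (D * d - D' * d'))"
    using assms by (intro dvd_add T_dvd *)
  then have "coeff ((A * a - A' * a') + T * ((B * c - B' * c') + (C * b - C' * b') + (D * d - D' * d'))) (n - 1) = 0"
    using m_pos m_le by (intro coeff_monom_dvd[of n]) auto
  then show ?thesis by (simp add: pairing_def algebra_simps)
qed

lemma functional_phi [simp]: "functional A B C D (\<Phi> a b c d) = pairing A B C D a b c d"
proof -
  have "(SOME y. \<exists>a' b' c' d'. \<Phi> a b c d = \<Phi> a' b' c' d' \<and> y = pairing A B C D a' b' c' d') = pairing A B C D a b c d"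
    by (rule some_equality, blast)
      (auto simp: phi_eq_iff intro!: pairing_eq dest: dvd_diff_commute[THEN iffD1])
  then show ?thesis by (simp add: functional_def)
qed

lemma in_V_cases: assumes "x \<in> V" obtains a b c d where "x = \<Phi> a b c d"
  using assms by (auto simp: centraliser_eq)

lemma functional_eqI:
  assumes "\<xi> \<in> extensional V" "\<And>a b c d. \<xi> (\<Phi> a b c d) = pairing A B C D a b c d"
  shows "\<xi> = functional A B C D"
proof (rule extensionalityI[OF assms(1)])
  show "functional A B C D \<in> extensional V" by (simp add: functional_def)
  show "\<xi> x = functional A B C D x" if "x \<in> V" for x
    using that by (elim in_V_cases) (simp add: assms(2))
qed

lemma functional_in_dual [simp]: "functional A B C D \<in> dual_space V"
proof -
  have "functional A B C D (x + y) = functional A B C D x + functional A B C D y"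
    if "x \<in> V" "y \<in> V" for x y
    using that by (elim in_V_cases) (simp add: phi_add pairing_def algebra_simps)
  moreover have "functional A B C D (k \<cdot>\<^sub>m x) = k * functional A B C D x" if "x \<in> V" for k x
    using that by (elim in_V_cases) (simp add: phi_smult pairing_def algebra_simps)
  ultimately show ?thesis by (auto simp: dual_space_def functional_def)
qed

lemma functional_cong:
  assumes "monom 1 n dvd A - A'" "monom 1 m dvd B - B'" "monom 1 m dvd C - C'" "monom 1 m dvd D - D'"
  shows "functional A B C D = functional A' B' C' D'"
proof (rule functional_eqI)
  show "functional A B C D \<in> extensional V" by (simp add: functional_def)
  show "functional A B C D (\<Phi> a b c d) = pairing A' B' C' D' a b c d" for a b c d
    using assms by (auto intro!: pairing_eq)
qed

lemma coeff_T_mult: "coeff (T * p) (n - 1) = coeff p (m - 1)"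
  using m_pos m_le by (simp add: coeff_monom_mult)

text \<open>Apply \<open>linear_functional_coeff\<close> on each of the four blocks. The trace form
  pairs opposite off-diagonal entries, so \<open>B\<close> is read off the \<open>c\<close>-block
  and \<open>C\<close> off the \<open>b\<close>-block.\<close>

lemma dual_cases:
  assumes "\<xi> \<in> dual_space V"
  obtains A B C D where "\<xi> = functional A B C D"
proof -
  have add: "\<xi> (\<Phi> a b c d + \<Phi> a' b' c' d') = \<xi> (\<Phi> a b c d) + \<xi> (\<Phi> a' b' c' d')" for a b c d a' b' c' d'
    using assms by (auto simp: dual_space_def)
  have smult: "\<xi> (k \<cdot>\<^sub>m \<Phi> a b c d) = k * \<xi> (\<Phi> a b c d)" for k a b c d
    using assms by (auto simp: dual_space_def)
  have zero: "\<xi> (\<Phi> a b c d) = 0" if "\<Phi> a b c d = 0\<^sub>m (n + m) (n + m)" for a b c d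
    using smult[of 0 a b c d] unfolding that by simp
  have n: "0 < n" using m_pos m_le by simp
  define A where "A = (\<Sum>i<n. monom (\<xi> (\<Phi> (monom 1 (n - 1 - i)) 0 0 0)) i)"
  define B where "B = (\<Sum>i<m. monom (\<xi> (\<Phi> 0 0 (monom 1 (m - 1 - i)) 0)) i)"
  define C where "C = (\<Sum>i<m. monom (\<xi> (\<Phi> 0 (monom 1 (m - 1 - i)) 0 0)) i)"
  define D where "D = (\<Sum>i<m. monom (\<xi> (\<Phi> 0 0 0 (monom 1 (m - 1 - i)))) i)"
  have A: "\<xi> (\<Phi> p 0 0 0) = coeff (A * p) (n - 1)" for p
    unfolding A_def by (rule linear_functional_coeff)
      (use add[of _ 0 0 0 _ 0 0 0] smult[of _ _ 0 0 0] in \<open>auto intro!: zero simp: phi_eq_0_iff n phi_add phi_smult\<close>)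
  have B: "\<xi> (\<Phi> 0 0 p 0) = coeff (B * p) (m - 1)" for p
    unfolding B_def by (rule linear_functional_coeff)
      (use add[of 0 0 _ 0 0 0 _ 0] smult[of _ 0 0 _ 0] in \<open>auto intro!: zero simp: phi_eq_0_iff m_pos phi_add phi_smult\<close>)
  have C: "\<xi> (\<Phi> 0 p 0 0) = coeff (C * p) (m - 1)" for p
    unfolding C_def by (rule linear_functional_coeff)
      (use add[of 0 _ 0 0 0 _ 0 0] smult[of _ 0 _ 0 0] in \<open>auto intro!: zero simp: phi_eq_0_iff m_pos phi_add phi_smult\<close>)
  have D: "\<xi> (\<Phi> 0 0 0 p) = coeff (D * p) (m - 1)" for p
    unfolding D_def by (rule linear_functional_coeff)
      (use add[of 0 0 0 _ 0 0 0 _] smult[of _ 0 0 0 _] in \<open>auto intro!: zero simp: phi_eq_0_iff m_pos phi_add phi_smult\<close>)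
  have "\<xi> (\<Phi> a b c d) = pairing A B C D a b c d" for a b c d
  proof -
    have 1: "\<Phi> a b c d = \<Phi> a b 0 0 + \<Phi> 0 0 c d" and 2: "\<Phi> a b 0 0 = \<Phi> a 0 0 0 + \<Phi> 0 b 0 0"
      and 3: "\<Phi> 0 0 c d = \<Phi> 0 0 c 0 + \<Phi> 0 0 0 d"
      unfolding phi_add by simp_all
    have "\<xi> (\<Phi> a b c d) = coeff (A * a) (n - 1) + coeff (C * b) (m - 1) + (coeff (B * c) (m - 1) + coeff (D * d) (m - 1))"
      unfolding 1 add unfolding 2 3 add A B C D ..
    then show ?thesis unfolding pairing_def coeff_add coeff_T_mult by simp
  qed
  moreover have "\<xi> \<in> extensional V" using assms by (simp add: dual_space_def)
  ultimately show ?thesis using functional_eqI that by blast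
qed

lemma coeff_functional:
  "i < n \<Longrightarrow> functional A B C D (\<Phi> (monom 1 (n - 1 - i)) 0 0 0) = coeff A i"
  "i < m \<Longrightarrow> functional A B C D (\<Phi> 0 0 (monom 1 (m - 1 - i)) 0) = coeff B i"
  "i < m \<Longrightarrow> functional A B C D (\<Phi> 0 (monom 1 (m - 1 - i)) 0 0) = coeff C i"
  "i < m \<Longrightarrow> functional A B C D (\<Phi> 0 0 0 (monom 1 (m - 1 - i))) = coeff D i"
proof -
  have *: "coeff (p * monom 1 (N - 1 - i)) (N - 1) = coeff p i" if "i < N" for N and p :: "'a poly"
    using that by (subst mult.commute) (simp add: coeff_monom_mult)
  show "i < n \<Longrightarrow> functional A B C D (\<Phi> (monom 1 (n - 1 - i)) 0 0 0) = coeff A i"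
    using *[of n A] by (simp add: pairing_def)
  show "i < m \<Longrightarrow> functional A B C D (\<Phi> 0 0 (monom 1 (m - 1 - i)) 0) = coeff B i"
    using *[of m B] coeff_T_mult[of "B * monom 1 (m - 1 - i)"] by (simp add: pairing_def)
  show "i < m \<Longrightarrow> functional A B C D (\<Phi> 0 (monom 1 (m - 1 - i)) 0 0) = coeff C i"
    using *[of m C] coeff_T_mult[of "C * monom 1 (m - 1 - i)"] by (simp add: pairing_def)
  show "i < m \<Longrightarrow> functional A B C D (\<Phi> 0 0 0 (monom 1 (m - 1 - i))) = coeff D i"
    using *[of m D] coeff_T_mult[of "D * monom 1 (m - 1 - i)"] by (simp add: pairing_def)
qed

section \<open>Polynomial curves, closed sets and irreducibility\<close>

definition curve :: "'a poly poly \<Rightarrow> 'a poly poly \<Rightarrow> 'a poly poly \<Rightarrow> 'a poly poly \<Rightarrow> 'a \<Rightarrow> ('a mat \<Rightarrow> 'a)" where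
  "curve A B C D \<tau> = functional (specialise \<tau> A) (specialise \<tau> B) (specialise \<tau> C) (specialise \<tau> D)"

lemma sym_alg_curve:
  assumes "p \<in> sym_alg V"
  shows "\<exists>P. \<forall>\<tau>. p (curve A B C D \<tau>) = poly P \<tau>"
  using assms
proof induction
  case (sym_alg_const c)
  show ?case by (rule exI[of _ "[:c:]"]) (simp add: curve_def)
next
  case (sym_alg_eval x)
  then obtain a b c d where x: "x = \<Phi> a b c d" by (rule in_V_cases)
  \<comment> \<open>The pairing is formed over \<open>F[\<tau>]\<close> first; its coefficient of
    \<open>t^(n-1)\<close> is the required polynomial in \<tau>.\<close>
  let ?P = "A * lift_poly a + monom 1 (n - m) * (B * lift_poly c + C * lift_poly b + D * lift_poly d)"
  have "functional (specialise \<tau> A) (specialise \<tau> B) (specialise \<tau> C) (specialise \<tau> D) x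
      = coeff (specialise \<tau> ?P) (n - 1)" for \<tau>
    by (simp add: x pairing_def)
  then show ?case by (intro exI[of _ "coeff ?P (n - 1)"]) (simp add: curve_def del: specialise_hom)
next
  case (sym_alg_add p q)
  then obtain P Q where "\<forall>\<tau>. p (curve A B C D \<tau>) = poly P \<tau>" "\<forall>\<tau>. q (curve A B C D \<tau>) = poly Q \<tau>" by blast
  then show ?case by (intro exI[of _ "P + Q"]) (simp add: curve_def)
next
  case (sym_alg_mult p q)
  then obtain P Q where "\<forall>\<tau>. p (curve A B C D \<tau>) = poly P \<tau>" "\<forall>\<tau>. q (curve A B C D \<tau>) = poly Q \<tau>" by blast
  then show ?case by (intro exI[of _ "P * Q"]) (simp add: curve_def)
qed

text \<open>Each equation of \<open>S\<close> restricts to a polynomial in \<tau>; having infinitely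
  many roots, it is zero.\<close>

lemma curve_in_closed:
  assumes "closedin (zariski V) S" "infinite {\<tau>. curve A B C D \<tau> \<in> S}"
  shows "curve A B C D \<tau> \<in> S"
proof -
  from assms(1) obtain F where F: "F \<subseteq> sym_alg V" "S = {\<xi> \<in> dual_space V. \<forall>p\<in>F. p \<xi> = 0}"
    unfolding closedin_zariski by blast
  have "p (curve A B C D \<tau>) = 0" if p: "p \<in> F" for p
  proof -
    obtain P where P: "\<And>\<tau>. p (curve A B C D \<tau>) = poly P \<tau>"
      using sym_alg_curve[of p A B C D] p F(1) by auto
    have "{\<tau>. curve A B C D \<tau> \<in> S} \<subseteq> {\<tau>. poly P \<tau> = 0}" using F(2) p P by auto
    then have "P = 0" using assms(2) poly_roots_finite finite_subset by blast
    then show ?thesis by (simp add: P)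
  qed
  then show ?thesis by (simp add: F(2) curve_def)
qed

text \<open>Join a point outside \<open>E\<close> to a point outside \<open>F\<close>. The field is
  infinite, so one of the two closed sets contains infinitely many points of the curve, counted by
  parameter, hence the whole curve with both ends.\<close>

lemma irreducible_if_curves:
  assumes "S \<subseteq> dual_space V" "S \<noteq> {}"
    and "\<And>x y. x \<in> S \<Longrightarrow> y \<in> S \<Longrightarrow>
      \<exists>A B C D. curve A B C D 0 = x \<and> curve A B C D 1 = y \<and> (\<forall>\<tau>. curve A B C D \<tau> \<in> S)"
  shows "irreducible_in (zariski V) S"
  unfolding irreducible_in_def
proof (intro conjI allI impI)
  fix E F assume EF: "closedin (zariski V) E" "closedin (zariski V) F" "S \<subseteq> E \<union> F"
  show "S \<subseteq> E \<or> S \<subseteq> F"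
  proof (rule ccontr)
    assume "\<not> (S \<subseteq> E \<or> S \<subseteq> F)"
    then obtain x y where xy: "x \<in> S" "x \<notin> E" "y \<in> S" "y \<notin> F" by blast
    then obtain A B C D where c: "curve A B C D 0 = x" "curve A B C D 1 = y" "\<forall>\<tau>. curve A B C D \<tau> \<in> S"
      using assms(3) by blast
    have "{\<tau>. curve A B C D \<tau> \<in> E} \<union> {\<tau>. curve A B C D \<tau> \<in> F} = UNIV" using c(3) EF(3) by auto
    then have "infinite {\<tau>. curve A B C D \<tau> \<in> E} \<or> infinite {\<tau>. curve A B C D \<tau> \<in> F}"
      by (metis finite_UnI infinite_UNIV_char_0)
    then show False using curve_in_closed EF(1,2) c(1,2) xy(2,4) by metis
  qed
qed (use assms in auto)

section \<open>The stabiliser and the coadjoint action in coordinates\<close>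

lemma stabiliser_cases:
  assumes "g \<in> stabiliser e"
  obtains g1 g2 g3 g4 h1 h2 h3 h4 where "g = \<Phi> g1 g2 g3 g4" "inv\<^bsub>R\<^esub> g = \<Phi> h1 h2 h3 h4"
    "\<Phi> g1 g2 g3 g4 * \<Phi> h1 h2 h3 h4 = 1\<^sub>m (n + m)" "\<Phi> h1 h2 h3 h4 * \<Phi> g1 g2 g3 g4 = 1\<^sub>m (n + m)"
proof -
  interpret ring R by (rule ring_mat)
  have dim: "dim_row e = n + m" using e_carrier by auto
  have g: "g \<in> Units R" and eq: "g * e * inv\<^bsub>R\<^esub> g = e"
    using assms by (auto simp: stabiliser_def Let_def dim)
  let ?h = "inv\<^bsub>R\<^esub> g"
  have gc: "g \<in> carrier_mat (n + m) (n + m)" and hc: "?h \<in> carrier_mat (n + m) (n + m)"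
    using g Units_closed[OF g] Units_inv_closed[OF g] by (auto simp: ring_mat_simps)
  have gh: "g * ?h = 1\<^sub>m (n + m)" and hg: "?h * g = 1\<^sub>m (n + m)"
    using Units_r_inv[OF g] Units_l_inv[OF g] by (simp_all add: ring_mat_simps)
  note assoc = assoc_mult_mat[of _ "n + m" "n + m" _ "n + m" _ "n + m"]
  have "e * g = g * e * ?h * g" by (simp add: eq)
  also have "\<dots> = g * e" using gc hc e_carrier hg by (simp add: assoc)
  finally have 1: "g \<in> V" using gc by (simp add: centraliser_iff[OF e_carrier])
  have "?h * e = ?h * (g * e * ?h)" by (simp add: eq)
  also have "\<dots> = (?h * g) * e * ?h" using gc hc e_carrier by (simp add: assoc)
  also have "\<dots> = e * ?h" using hc e_carrier hg by simp
  finally have 2: "?h \<in> V" using hc by (simp add: centraliser_iff[OF e_carrier])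
  obtain g1 g2 g3 g4 where g': "g = \<Phi> g1 g2 g3 g4" using 1 by (rule in_V_cases)
  obtain h1 h2 h3 h4 where h': "?h = \<Phi> h1 h2 h3 h4" using 2 by (rule in_V_cases)
  show ?thesis by (rule that[OF g' h']) (use gh hg g' h' in simp_all)
qed

lemma phi_stabiliser:
  assumes gh: "\<Phi> g1 g2 g3 g4 * \<Phi> h1 h2 h3 h4 = 1\<^sub>m (n + m)" and hg: "\<Phi> h1 h2 h3 h4 * \<Phi> g1 g2 g3 g4 = 1\<^sub>m (n + m)"
  shows "\<Phi> g1 g2 g3 g4 \<in> stabiliser e" "inv\<^bsub>R\<^esub> (\<Phi> g1 g2 g3 g4) = \<Phi> h1 h2 h3 h4"
proof -
  interpret ring R by (rule ring_mat)
  have dim: "dim_row e = n + m" using e_carrier by auto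
  let ?g = "\<Phi> g1 g2 g3 g4" and ?h = "\<Phi> h1 h2 h3 h4"
  show inv: "inv\<^bsub>R\<^esub> ?g = ?h"
    by (rule inv_char) (simp_all add: ring_mat_simps gh hg)
  have "?g \<in> Units R"
    unfolding Units_def using gh hg phi_carrier by (auto simp: ring_mat_simps)
  moreover have "?g * e * ?h = e"
  proof -
    have "?g * e * ?h = e * (?g * ?h)"
      unfolding phi_comm using e_carrier by (intro assoc_mult_mat) auto
    then show ?thesis using gh e_carrier by simp
  qed
  ultimately show "?g \<in> stabiliser e" by (simp add: stabiliser_def Let_def dim inv)
qed

text \<open>By cyclicity of the trace, \<Xi> is replaced by \<open>g \<Xi> h\<close> with
  \<open>h\<close> the inverse of \<open>g\<close>. The common factor \<open>T\<close> of the second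
  row is divided out.\<close>

lemma coadj_functional:
  assumes "inv\<^bsub>R\<^esub> (\<Phi> g1 g2 g3 g4) = \<Phi> h1 h2 h3 h4"
  shows "coadj e (\<Phi> g1 g2 g3 g4) (functional A B C D) = functional
    ((g1 * A + T * (g2 * C)) * h1 + T * ((g1 * B + T * (g2 * D)) * h3))
    ((g1 * A + T * (g2 * C)) * h2 + (g1 * B + T * (g2 * D)) * h4)
    ((g3 * A + g4 * C) * h1 + T * ((g3 * B + g4 * D) * h3))
    ((g3 * A + g4 * C) * h2 + (g3 * B + g4 * D) * h4)"
proof (rule functional_eqI)
  have dim: "dim_row e = n + m" using e_carrier by auto
  show "coadj e (\<Phi> g1 g2 g3 g4) (functional A B C D) \<in> extensional V" by (simp add: coadj_def)
  show "coadj e (\<Phi> g1 g2 g3 g4) (functional A B C D) (\<Phi> a b c d) = pairing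
    ((g1 * A + T * (g2 * C)) * h1 + T * ((g1 * B + T * (g2 * D)) * h3))
    ((g1 * A + T * (g2 * C)) * h2 + (g1 * B + T * (g2 * D)) * h4)
    ((g3 * A + g4 * C) * h1 + T * ((g3 * B + g4 * D) * h3))
    ((g3 * A + g4 * C) * h2 + (g3 * B + g4 * D) * h4) a b c d" for a b c d
    unfolding coadj_def dim assms
    by (simp add: assms phi_mult) (unfold pairing_def, rule arg_cong[where f = "\<lambda>p. coeff p (n - 1)"], simp add: algebra_simps)
qed

end

section \<open>Equations of the null-cone\<close>

lemma homogeneous_in_sym_alg: "homogeneous V d p \<Longrightarrow> p \<in> sym_alg V"
proof (induction rule: homogeneous.induct)
  case (homogeneous_mult x d p)
  have "(\<lambda>\<xi>\<in>dual_space V. \<xi> x * p \<xi>) = (\<lambda>\<xi>\<in>dual_space V. (\<lambda>\<xi>\<in>dual_space V. \<xi> x) \<xi> * p \<xi>)"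
    by (auto simp: restrict_def)
  also have "\<dots> \<in> sym_alg V"
    using homogeneous_mult by (intro sym_alg_mult sym_alg_eval)
  finally show ?case .
qed (rule sym_alg.intros; assumption?)+

lemma homogeneous_eval:
  assumes "x \<in> V"
  shows "homogeneous V (Suc 0) (\<lambda>\<xi>\<in>dual_space V. \<xi> x)"
  using homogeneous_mult[OF assms homogeneous_const[of V 1]]
  by (simp add: restrict_def cong: if_cong)

lemma homogeneous_eval_mult:
  assumes "x \<in> V" "y \<in> V"
  shows "homogeneous V 2 (\<lambda>\<xi>\<in>dual_space V. \<xi> x * \<xi> y)"
  using homogeneous_mult[OF assms(1) homogeneous_eval[OF assms(2)]]
  by (simp add: restrict_def numeral_2_eq_2 cong: if_cong)

lemma homogeneous_sum:
  assumes "finite I" "\<And>i. i \<in> I \<Longrightarrow> homogeneous V d (\<lambda>\<xi>\<in>dual_space V. f i \<xi>)"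
  shows "homogeneous V d (\<lambda>\<xi>\<in>dual_space V. \<Sum>i\<in>I. f i \<xi>)"
  using assms
proof (induction I)
  case empty
  show ?case unfolding sum.empty by (rule homogeneous_zero)
next
  case (insert j I)
  have "homogeneous V d (\<lambda>\<xi>\<in>dual_space V. (\<lambda>\<xi>\<in>dual_space V. f j \<xi>) \<xi> + (\<lambda>\<xi>\<in>dual_space V. \<Sum>i\<in>I. f i \<xi>) \<xi>)"
    by (intro homogeneous_add insert.IH insert.prems) auto
  then show ?case using insert.hyps by (simp add: restrict_def cong: if_cong)
qed

lemma poly_inverse_mod_monom:
  fixes B :: "'a::field poly"
  assumes "coeff B 0 \<noteq> 0"
  shows "\<exists>f. monom 1 N dvd f * B - 1"
proof (induction N)
  case 0
  then show ?case by (simp add: monom_0 flip: one_pCons)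
next
  case (Suc N)
  then obtain f q where q: "f * B - 1 = monom 1 N * q" by (auto elim: dvdE)
  \<comment> \<open>This constant kills the constant term of the error \<open>q\<close>, which gains
    one more factor \<open>t\<close>.\<close>
  let ?c = "coeff q 0 / coeff B 0"
  have "monom 1 1 dvd q - [:?c:] * B"
    using assms by (simp add: monom_1_dvd_iff' del: One_nat_def)
  then have "monom 1 N * monom 1 1 dvd monom 1 N * (q - [:?c:] * B)" by (intro mult_dvd_mono) auto
  also have "monom 1 N * (q - [:?c:] * B) = (f - [:?c:] * monom 1 N) * B - 1"
    using q by (simp add: algebra_simps)
  finally show ?case by (auto simp: mult_monom)
qed

lemma coeff_eq_if_dvd_diff: "monom 1 N dvd p - q \<Longrightarrow> i < N \<Longrightarrow> coeff p i = coeff q i"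
  for p q :: "'a::comm_ring_1 poly"
  using coeff_monom_dvd[of N "p - q" i] by simp

text \<open>Multiplicativity of the determinant for \<open>g \<Xi> h\<close>, with \<open>t\<close>
  divided out of the second row. The first factor is \<open>det (g h) - 1\<close>, arranged so that
  each summand contains an entry of \<open>g h - 1\<close>.\<close>

lemma det_conj_identity:
  fixes t :: "'a::comm_ring_1"
  shows "((g1 * h1 + t * (g2 * h3) - 1) * (t * (g3 * h2) + g4 * h4) + (t * (g3 * h2) + g4 * h4 - 1) -
      (g1 * h2 + g2 * h4) * (t * (g3 * h1 + g4 * h3))) * (A * D - B * C) =
    ((g1 * A + t * (g2 * C)) * h1 + t * ((g1 * B + t * (g2 * D)) * h3)) *
    ((g3 * A + g4 * C) * h2 + (g3 * B + g4 * D) * h4) -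
    ((g1 * A + t * (g2 * C)) * h2 + (g1 * B + t * (g2 * D)) * h4) *
    ((g3 * A + g4 * C) * h1 + t * ((g3 * B + g4 * D) * h3)) - (A * D - B * C)"
  by (simp add: algebra_simps)

context jordan_pair
begin

section \<open>Invariants of degree one and two\<close>

lemma functional_neg: "functional A B C D (\<Phi> 0 0 (- p) 0) = - functional A B C D (\<Phi> 0 0 p 0)"
  by (simp add: pairing_def)

text \<open>Evaluation at the scalar matrix \<open>t^(n-1-i)\<close>, which is central in the
  centraliser; this makes it invariant.\<close>

definition linear_invariant :: "nat \<Rightarrow> ('a mat \<Rightarrow> 'a) \<Rightarrow> 'a" where
  "linear_invariant i = (\<lambda>\<xi>\<in>dual_space V. \<xi> (\<Phi> (monom 1 (n - 1 - i)) 0 0 (monom 1 (n - 1 - i))))"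

text \<open>A coefficient of the determinant \<open>A D - B C\<close>, written through evaluations.
  The sign sits inside an evaluation, so that only sums and products occur, as
  \<open>homogeneous\<close> demands.\<close>

definition quadratic_invariant :: "nat \<Rightarrow> ('a mat \<Rightarrow> 'a) \<Rightarrow> 'a" where
  "quadratic_invariant i = (\<lambda>\<xi>\<in>dual_space V. \<Sum>k\<le>i.
      \<xi> (\<Phi> (monom 1 (n - 1 - k)) 0 0 0) * \<xi> (\<Phi> 0 0 0 (monom 1 (m - 1 - (i - k)))) +
      \<xi> (\<Phi> 0 0 (- monom 1 (m - 1 - k)) 0) * \<xi> (\<Phi> 0 (monom 1 (m - 1 - (i - k))) 0 0))"

lemma linear_invariant_homogeneous: "homogeneous V 1 (linear_invariant i)"
  unfolding linear_invariant_def One_nat_def by (rule homogeneous_eval) simp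

lemma quadratic_invariant_homogeneous: "homogeneous V 2 (quadratic_invariant i)"
  unfolding quadratic_invariant_def
proof (rule homogeneous_sum)
  fix k
  have "homogeneous V 2 (\<lambda>\<xi>\<in>dual_space V.
    (\<lambda>\<xi>\<in>dual_space V. \<xi> (\<Phi> (monom 1 (n - 1 - k)) 0 0 0) * \<xi> (\<Phi> 0 0 0 (monom 1 (m - 1 - (i - k))))) \<xi> +
    (\<lambda>\<xi>\<in>dual_space V. \<xi> (\<Phi> 0 0 (- monom 1 (m - 1 - k)) 0) * \<xi> (\<Phi> 0 (monom 1 (m - 1 - (i - k))) 0 0)) \<xi>)"
    by (intro homogeneous_add homogeneous_eval_mult) auto
  then show "homogeneous V 2 (\<lambda>\<xi>\<in>dual_space V.
    \<xi> (\<Phi> (monom 1 (n - 1 - k)) 0 0 0) * \<xi> (\<Phi> 0 0 0 (monom 1 (m - 1 - (i - k)))) +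
    \<xi> (\<Phi> 0 0 (- monom 1 (m - 1 - k)) 0) * \<xi> (\<Phi> 0 (monom 1 (m - 1 - (i - k))) 0 0))"
    by (simp add: restrict_def cong: if_cong)
qed auto

lemma linear_invariant_functional:
  assumes "i < n"
  shows "linear_invariant i (functional A B C D) = coeff (A + T * D) i"
proof -
  have "functional A B C D (\<Phi> (monom 1 (n - 1 - i)) 0 0 (monom 1 (n - 1 - i))) =
      coeff (monom 1 (n - 1 - i) * (A + T * D)) (n - 1)"
    by (simp only: functional_phi pairing_def) (simp only: mult_zero_right add_0_left ring_distribs mult_ac)
  also have "\<dots> = coeff (A + T * D) i" using assms by (simp add: coeff_monom_mult)
  finally show ?thesis by (simp add: linear_invariant_def del: functional_phi)
qed

lemma quadratic_invariant_functional:
  assumes "i < m"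
  shows "quadratic_invariant i (functional A B C D) = coeff (A * D - B * C) i"
proof -
  have "quadratic_invariant i (functional A B C D) =
      (\<Sum>k\<le>i. coeff A k * coeff D (i - k) + - coeff B k * coeff C (i - k))"
    unfolding quadratic_invariant_def restrict_apply'[OF functional_in_dual] functional_neg
    using assms m_le by (intro sum.cong refl) (simp only: coeff_functional atMost_iff)
  then show ?thesis by (simp add: coeff_mult sum_subtractf)
qed

lemma linear_invariant_in_invariants: "linear_invariant i \<in> sym_invariants e"
  unfolding sym_invariants_def
proof (intro CollectI conjI ballI)
  show "linear_invariant i \<in> sym_alg V"
    using linear_invariant_homogeneous by (rule homogeneous_in_sym_alg)
  fix g \<xi> assume g: "g \<in> stabiliser e" and \<xi>: "\<xi> \<in> dual_space V"
  obtain A B C D where \<xi>_eq: "\<xi> = functional A B C D" using \<xi> by (rule dual_cases)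
  obtain g1 g2 g3 g4 h1 h2 h3 h4 where gh: "g = \<Phi> g1 g2 g3 g4" "inv\<^bsub>R\<^esub> g = \<Phi> h1 h2 h3 h4"
    "\<Phi> h1 h2 h3 h4 * \<Phi> g1 g2 g3 g4 = 1\<^sub>m (n + m)"
    using g by (rule stabiliser_cases)
  let ?z = "\<Phi> (monom 1 (n - 1 - i)) 0 0 (monom 1 (n - 1 - i))"
  have dim: "dim_row e = n + m" using e_carrier by auto
  have "coadj e g \<xi> \<in> dual_space V"
    unfolding \<xi>_eq gh(1) coadj_functional[OF gh(2)[unfolded gh(1)]] by simp
  moreover have "\<Phi> h1 h2 h3 h4 * ?z * \<Phi> g1 g2 g3 g4 = ?z * (\<Phi> h1 h2 h3 h4 * \<Phi> g1 g2 g3 g4)"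
    unfolding phi_mult by (rule arg_cong2[where f = "\<lambda>a b. a b"]; simp add: algebra_simps)
  ultimately show "linear_invariant i (coadj e g \<xi>) = linear_invariant i \<xi>"
    using \<xi> gh by (simp add: linear_invariant_def coadj_def dim right_mult_one_mat[OF phi_carrier])
qed

lemma quadratic_invariant_in_invariants:
  assumes i: "i < m"
  shows "quadratic_invariant i \<in> sym_invariants e"
  unfolding sym_invariants_def
proof (intro CollectI conjI ballI)
  show "quadratic_invariant i \<in> sym_alg V"
    using quadratic_invariant_homogeneous by (rule homogeneous_in_sym_alg)
  fix g \<xi> assume g: "g \<in> stabiliser e" and \<xi>: "\<xi> \<in> dual_space V"
  obtain A B C D where \<xi>_eq: "\<xi> = functional A B C D" using \<xi> by (rule dual_cases)
  obtain g1 g2 g3 g4 h1 h2 h3 h4 where gh: "g = \<Phi> g1 g2 g3 g4" "inv\<^bsub>R\<^esub> g = \<Phi> h1 h2 h3 h4"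
    "\<Phi> g1 g2 g3 g4 * \<Phi> h1 h2 h3 h4 = 1\<^sub>m (n + m)"
    using g by (rule stabiliser_cases)
  \<comment> \<open>These are the entries of \<open>g\<close> times its inverse; they agree with
    those of the identity only up to the moduli.\<close>
  define a b c d where "a = g1 * h1 + T * (g2 * h3)" and "b = g1 * h2 + g2 * h4"
    and "c = g3 * h1 + g4 * h3" and "d = T * (g3 * h2) + g4 * h4"
  have "\<Phi> a b c d = \<Phi> 1 0 0 1" using gh(3) by (simp add: phi_mult phi_one a_def b_def c_def d_def)
  then have dvd: "monom 1 n dvd a - 1" "monom 1 m dvd b" "monom 1 m dvd d - 1"
    by (simp_all add: phi_eq_iff)
  have "monom 1 m dvd a - 1" using dvd(1) m_le by (auto simp: monom_1_dvd_iff')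
  then have "monom 1 m dvd ((a - 1) * d + (d - 1) - b * (T * c)) * (A * D - B * C)"
    using dvd(2,3) by (metis dvd_mult2 dvd_diff dvd_add)
  also have "((a - 1) * d + (d - 1) - b * (T * c)) * (A * D - B * C) =
     (((g1 * A + T * (g2 * C)) * h1 + T * ((g1 * B + T * (g2 * D)) * h3)) *
      ((g3 * A + g4 * C) * h2 + (g3 * B + g4 * D) * h4) -
      ((g1 * A + T * (g2 * C)) * h2 + (g1 * B + T * (g2 * D)) * h4) *
      ((g3 * A + g4 * C) * h1 + T * ((g3 * B + g4 * D) * h3))) - (A * D - B * C)"
    unfolding a_def b_def c_def d_def by (rule det_conj_identity)
  finally show "quadratic_invariant i (coadj e g \<xi>) = quadratic_invariant i \<xi>"
    unfolding \<xi>_eq gh(1) coadj_functional[OF gh(2)[unfolded gh(1)]] quadratic_invariant_functional[OF i]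
    using i by (rule coeff_eq_if_dvd_diff)
qed

text \<open>The functionals with \<open>B = 1\<close> and \<open>D = 0\<close> form a section of the quotient map that meets the
  orbit of every \<open>\<xi>\<close> with \<open>B\<close> invertible.\<close>

lemma coadj_into_section:
  assumes "coeff B 0 \<noteq> 0"
  shows "\<exists>g\<in>stabiliser e. coadj e g (functional A B C D) = functional (A + T * D) 1 (B * C - A * D) 0"
proof -
  obtain f where f: "monom 1 n dvd f * B - 1" using poly_inverse_mod_monom[OF assms] by blast
  have f': "monom 1 m dvd f * B - 1" using f m_le by (auto simp: monom_1_dvd_iff')
  \<comment> \<open>The upper left entry of \<open>?g\<close> scales \<open>B\<close> to 1, and the
    lower left one then clears \<open>D\<close>.\<close>
  let ?g = "\<Phi> f 0 (- (D * f)) 1" and ?h = "\<Phi> B 0 D 1"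
  have "monom 1 m dvd D - D * (f * B)"
    using dvd_mult[OF f', of "- D"] by (simp add: algebra_simps)
  then have gh: "?g * ?h = 1\<^sub>m (n + m)" and hg: "?h * ?g = 1\<^sub>m (n + m)"
    unfolding phi_mult phi_one[symmetric] phi_eq_iff using f by (simp_all add: algebra_simps)
  have "coadj e ?g (functional A B C D) = functional (A + T * D) 1 (B * C - A * D) 0"
    unfolding coadj_functional[OF phi_stabiliser(2)[OF gh hg]]
  proof (rule functional_cong)
    have "monom 1 n dvd (f * B - 1) * (A + T * D)" using f by simp
    then show "monom 1 n dvd (f * A + T * (0 * C)) * B + T * ((f * B + T * (0 * D)) * D) - (A + T * D)"
      by (simp add: algebra_simps)
    show "monom 1 m dvd (f * A + T * (0 * C)) * 0 + (f * B + T * (0 * D)) * 1 - 1" using f' by simp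
    have "monom 1 m dvd (f * B - 1) * (- (A * D) - T * (D * D))" using f' by simp
    then show "monom 1 m dvd (- (D * f) * A + 1 * C) * B + T * ((- (D * f) * B + 1 * D) * D) - (B * C - A * D)"
      by (simp add: algebra_simps)
    have "monom 1 m dvd (f * B - 1) * (- D)" using f' by (intro dvd_mult2)
    then show "monom 1 m dvd (- (D * f) * A + 1 * C) * 0 + (- (D * f) * B + 1 * D) * 1 - 0"
      by (simp add: algebra_simps)
  qed
  then show ?thesis using phi_stabiliser(1)[OF gh hg] by blast
qed

text \<open>The density argument: replacing \<open>B\<close> by \<open>B + \<tau>\<close> makes it
  invertible for all but one \<tau>. Both sides are polynomials in \<tau> that agree there, hence
  also at 0.\<close>

lemma invariant_on_section:
  assumes p: "p \<in> sym_invariants e"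
  shows "p (functional A B C D) = p (functional (A + T * D) 1 (B * C - A * D) 0)"
proof -
  let ?B = "lift_poly B + [:[:0, 1:]:]"
  have B: "specialise \<tau> ?B = B + [:\<tau>:]" for \<tau> by simp
  have psym: "p \<in> sym_alg V" using p by (simp add: sym_invariants_def)
  obtain P where P: "\<And>\<tau>. p (curve (lift_poly A) ?B (lift_poly C) (lift_poly D) \<tau>) = poly P \<tau>"
    using sym_alg_curve[OF psym] by blast
  obtain Q where Q: "\<And>\<tau>. p (curve (lift_poly (A + T * D)) 1 (?B * lift_poly C - lift_poly (A * D)) 0 \<tau>) = poly Q \<tau>"
    using sym_alg_curve[OF psym] by blast
  have "poly (P - Q) \<tau> = 0" if "\<tau> \<noteq> - coeff B 0" for \<tau>
  proof -
    have "coeff (B + [:\<tau>:]) 0 \<noteq> 0" using that by (auto simp: add_eq_0_iff)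
    then obtain g where g: "g \<in> stabiliser e" "coadj e g (functional A (B + [:\<tau>:]) C D)
        = functional (A + T * D) 1 ((B + [:\<tau>:]) * C - A * D) 0"
      using coadj_into_section by blast
    have "p (functional A (B + [:\<tau>:]) C D) = p (functional (A + T * D) 1 ((B + [:\<tau>:]) * C - A * D) 0)"
      using p g unfolding sym_invariants_def by (metis (mono_tags, lifting) CollectD functional_in_dual)
    then show ?thesis using P[of \<tau>] Q[of \<tau>] by (simp add: curve_def)
  qed
  then have "UNIV \<subseteq> insert (- coeff B 0) {\<tau>. poly (P - Q) \<tau> = 0}" by auto
  then have "P - Q = 0"
    using poly_roots_finite[of "P - Q"] infinite_UNIV_char_0[where ?'a = 'a] by (metis finite_insert finite_subset)
  then show ?thesis using P[of 0] Q[of 0] by (simp add: curve_def)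
qed

section \<open>The null-cone by equations\<close>

lemma homogeneous_at_zero:
  assumes "homogeneous V d p" "0 < d"
  shows "p (functional 0 0 0 0) = 0"
  using assms
proof induction
  case (homogeneous_mult x d p)
  from \<open>x \<in> V\<close> have "functional 0 0 0 0 x = 0" by (elim in_V_cases) (simp add: pairing_def)
  then show ?case by simp
qed auto

lemma null_cone_eq:
  "null_cone e = {functional (- (T * D)) B C D |B C D. monom 1 m dvd B * C + T * (D * D)}"
proof (rule equalityI; rule subsetI)
  fix \<xi> assume "\<xi> \<in> null_cone e"
  then have \<xi>: "\<xi> \<in> dual_space V" and inv: "\<And>p d. p \<in> sym_invariants e \<Longrightarrow> d > 0 \<Longrightarrow> homogeneous V d p \<Longrightarrow> p \<xi> = 0"
    by (auto simp: null_cone_def)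
  obtain A B C D where \<xi>_eq: "\<xi> = functional A B C D" using \<xi> by (rule dual_cases)
  have "coeff (A + T * D) i = 0" if "i < n" for i
    using inv[OF linear_invariant_in_invariants _ linear_invariant_homogeneous, of i]
      linear_invariant_functional[OF that, of A B C D] by (simp add: \<xi>_eq)
  then have A: "monom 1 n dvd A + T * D" by (simp add: monom_1_dvd_iff')
  then have Am: "monom 1 m dvd A + T * D" using m_le by (auto simp: monom_1_dvd_iff')
  have "coeff (A * D - B * C) i = 0" if "i < m" for i
    using inv[OF quadratic_invariant_in_invariants[OF that] _ quadratic_invariant_homogeneous]
      quadratic_invariant_functional[OF that, of A B C D] by (simp add: \<xi>_eq)
  then have "monom 1 m dvd A * D - B * C" by (simp add: monom_1_dvd_iff')
  \<comment> \<open>Eliminates \<open>A\<close> from the determinant equation by means of the linear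
    one.\<close>
  then have "monom 1 m dvd (A + T * D) * D - (A * D - B * C)"
    by (rule dvd_diff[OF dvd_mult2[OF Am]])
  then have "monom 1 m dvd B * C + T * (D * D)" by (simp add: algebra_simps)
  moreover have "\<xi> = functional (- (T * D)) B C D"
    unfolding \<xi>_eq by (rule functional_cong) (use A in auto)
  ultimately show "\<xi> \<in> {functional (- (T * D)) B C D |B C D. monom 1 m dvd B * C + T * (D * D)}" by blast
next
  fix \<xi> assume "\<xi> \<in> {functional (- (T * D)) B C D |B C D. monom 1 m dvd B * C + T * (D * D)}"
  then obtain B C D where \<xi>: "\<xi> = functional (- (T * D)) B C D" and dvd: "monom 1 m dvd B * C + T * (D * D)"
    by blast
  have "p \<xi> = 0" if p: "p \<in> sym_invariants e" "homogeneous V d p" "d > 0" for p d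
  proof -
    have "p \<xi> = p (functional 0 1 (B * C + T * (D * D)) 0)"
      unfolding \<xi> invariant_on_section[OF p(1), of "- (T * D)"] by (simp add: algebra_simps)
    also have "functional 0 1 (B * C + T * (D * D)) 0 = functional 0 1 0 0"
      by (rule functional_cong) (use dvd in auto)
    \<comment> \<open>The zero functional leads to the same point of the section, so an invariant
      takes there its value at zero.\<close>
    also have "p \<dots> = p (functional 0 0 0 0)"
      using invariant_on_section[OF p(1), of 0 0 0 0] by simp
    also have "\<dots> = 0" using homogeneous_at_zero p by blast
    finally show ?thesis .
  qed
  then show "\<xi> \<in> null_cone e" by (auto simp: null_cone_def \<xi>)
qed

lemma closedin_null_cone: "closedin (zariski V) (null_cone e)"
  unfolding closedin_zariski null_cone_def
  by (rule exI[of _ "{p \<in> sym_invariants e. \<exists>d>0. homogeneous V d p}"]) (auto simp: sym_invariants_def)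

end

section \<open>Irreducible components\<close>

lemma irreducible_in_closure_of:
  assumes "irreducible_in X S"
  shows "irreducible_in X (X closure_of S)"
proof -
  have S: "S \<subseteq> X closure_of S" using assms by (simp add: irreducible_in_def closure_of_subset)
  then show ?thesis
    using assms closure_of_subset_topspace[of X S] unfolding irreducible_in_def
    by (metis closure_of_minimal subset_empty subset_trans)
qed

lemma irreducible_in_subset_UN:
  assumes "finite I" "irreducible_in X Z" "\<And>i. i \<in> I \<Longrightarrow> closedin X (F i)" "Z \<subseteq> (\<Union>i\<in>I. F i)"
  shows "\<exists>i\<in>I. Z \<subseteq> F i"
  using assms
proof (induction I)
  case empty
  then show ?case by (auto simp: irreducible_in_def)
next
  case (insert j I)
  have "closedin X (F j)" "closedin X (\<Union>i\<in>I. F i)" "Z \<subseteq> F j \<union> (\<Union>i\<in>I. F i)"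
    using insert by (auto intro!: closedin_Union)
  then have "Z \<subseteq> F j \<or> Z \<subseteq> (\<Union>i\<in>I. F i)"
    using insert.prems(1) unfolding irreducible_in_def by blast
  then show ?case using insert by auto
qed

text \<open>An irreducible subset of the finite union lies in a single \<open>F i\<close>, so every
  maximal one is some \<open>F i\<close>; incomparability makes each \<open>F i\<close>
  maximal.\<close>

lemma irreducible_components_UN:
  assumes "finite I" "\<And>i. i \<in> I \<Longrightarrow> closedin X (F i)" "\<And>i. i \<in> I \<Longrightarrow> irreducible_in X (F i)"
    and "\<And>i j. i \<in> I \<Longrightarrow> j \<in> I \<Longrightarrow> F i \<subseteq> F j \<Longrightarrow> i = j"
  shows "irreducible_components X (\<Union>i\<in>I. F i) = F ` I"
proof (rule equalityI; rule subsetI)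
  fix Z assume "Z \<in> irreducible_components X (\<Union>i\<in>I. F i)"
  then have Z: "irreducible_in X Z" "Z \<subseteq> (\<Union>i\<in>I. F i)"
    and max: "\<And>Z'. irreducible_in X Z' \<Longrightarrow> Z' \<subseteq> (\<Union>i\<in>I. F i) \<Longrightarrow> Z \<subseteq> Z' \<Longrightarrow> Z' = Z"
    by (auto simp: irreducible_components_def)
  obtain i where "i \<in> I" "Z \<subseteq> F i"
    using irreducible_in_subset_UN[OF assms(1) Z(1) assms(2) Z(2)] by blast
  then show "Z \<in> F ` I" using max[OF assms(3)] by blast
next
  fix Z assume "Z \<in> F ` I"
  then obtain i where i: "i \<in> I" "Z = F i" by blast
  have "Z' = F i" if Z': "irreducible_in X Z'" "Z' \<subseteq> (\<Union>i\<in>I. F i)" "F i \<subseteq> Z'" for Z'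
  proof -
    obtain j where "j \<in> I" "Z' \<subseteq> F j"
      using irreducible_in_subset_UN[OF assms(1) Z'(1) assms(2) Z'(2)] by blast
    then show ?thesis using assms(4)[OF i(1), of j] Z'(3) by blast
  qed
  then show "Z \<in> irreducible_components X (\<Union>i\<in>I. F i)"
    using i assms(3) by (auto simp: irreducible_components_def)
qed

text \<open>Squaring doubles the order of vanishing: a first nonzero coefficient at
  \<open>k \<le> s div 2\<close> would give the square a nonzero coefficient at
  \<open>2k \<le> s\<close>.\<close>

lemma monom_dvd_power2:
  fixes p :: "'a::idom poly"
  assumes "monom 1 (Suc s) dvd p * p"
  shows "monom 1 (Suc (s div 2)) dvd p"
  unfolding monom_1_dvd_iff'
proof (intro allI impI)
  fix k assume "k < Suc (s div 2)"
  then show "coeff p k = 0"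
  proof (induction k rule: less_induct)
    case (less k)
    then have "monom 1 k dvd p" by (auto simp: monom_1_dvd_iff')
    then obtain q where q: "p = monom 1 k * q" by (elim dvdE)
    have "p * p = monom 1 (k + k) * (q * q)" by (simp add: q mult_ac mult_monom flip: mult.assoc)
    then have "coeff (p * p) (k + k) = coeff (q * q) 0" by (simp only: coeff_monom_mult) simp
    also have "\<dots> = coeff q 0 * coeff q 0" by (simp add: coeff_mult)
    finally have "coeff (p * p) (k + k) = coeff q 0 * coeff q 0" .
    moreover have "coeff (p * p) (k + k) = 0"
      using assms less.prems by (intro coeff_monom_dvd) auto
    ultimately show ?case by (simp add: q coeff_monom_mult)
  qed
qed

lemma monom_factor_mod:
  fixes B :: "'a::comm_ring_1 poly"
  obtains p \<mu> where "p \<le> m" "coeff \<mu> 0 \<noteq> 0" "monom 1 m dvd B - monom 1 p * \<mu>"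
proof (cases "monom 1 m dvd B")
  case True
  \<comment> \<open>A polynomial that vanishes modulo \<open>t^m\<close> gets order \<open>m\<close>
    and the unit 1.\<close>
  then show ?thesis by (intro that[of m 1]) auto
next
  case False
  then obtain i where "i < m" "coeff B i \<noteq> 0" by (auto simp: monom_1_dvd_iff')
  define p where "p = (LEAST i. coeff B i \<noteq> 0)"
  have "p \<le> i" "coeff B p \<noteq> 0" 
    using \<open>coeff B i \<noteq> 0\<close> LeastI[of "\<lambda>i. coeff B i \<noteq> 0" i] unfolding p_def by (auto intro: Least_le)
  moreover have "monom 1 p dvd B" unfolding p_def monom_1_dvd_iff' using not_less_Least by blast
  then obtain \<mu> where "B = monom 1 p * \<mu>" by (elim dvdE)
  ultimately show ?thesis using \<open>i < m\<close> by (intro that[of p \<mu>]) (auto simp: coeff_monom_mult)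
qed

lemma specialise_pCons [simp]: "specialise \<tau> (pCons c P) = pCons (poly c \<tau>) (specialise \<tau> P)"
  by (rule poly_eqI) (simp add: coeff_pCons split: nat.splits)

lemma specialise_smult [simp]: "specialise \<tau> (Polynomial.smult c P) = Polynomial.smult (poly c \<tau>) (specialise \<tau> P)"
  by (rule poly_eqI) simp

lemma poly_lift_poly [simp]: "poly (lift_poly p) q = pcompose p q"
  by (induction p) (simp_all add: lift_poly_def map_poly_pCons pcompose_pCons)

context jordan_pair
begin

section \<open>The pieces of the null-cone\<close>

definition cone_point :: "'a poly \<Rightarrow> 'a poly \<Rightarrow> 'a poly \<Rightarrow> 'a mat \<Rightarrow> 'a" where
  "cone_point B C D = functional (- (T * D)) B C D"

definition cone_curve :: "'a poly poly \<Rightarrow> 'a poly poly \<Rightarrow> 'a poly poly \<Rightarrow> 'a \<Rightarrow> 'a mat \<Rightarrow> 'a" where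
  "cone_curve B C D \<tau> = cone_point (specialise \<tau> B) (specialise \<tau> C) (specialise \<tau> D)"

lemma cone_curve_eq: "cone_curve B C D \<tau> = curve (- (monom 1 (n - m) * D)) B C D \<tau>"
  by (simp add: cone_curve_def cone_point_def curve_def)

lemma cone_point_cong:
  assumes "monom 1 m dvd B - B'" "monom 1 m dvd C - C'" "monom 1 m dvd D - D'"
  shows "cone_point B C D = cone_point B' C' D'"
  unfolding cone_point_def
proof (rule functional_cong)
  show "monom 1 n dvd - (T * D) - - (T * D')"
    using T_dvd[OF assms(3)] by (simp add: algebra_simps dvd_diff_commute)
qed (use assms in auto)

lemma null_cone_eq_cone_point:
  "null_cone e = {cone_point B C D |B C D. monom 1 m dvd B * C + T * (D * D)}"
  by (simp add: null_cone_eq cone_point_def)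

abbreviation k\<^sub>0 :: nat where "k\<^sub>0 \<equiv> min (n - m) m"

definition piece_point :: "nat \<Rightarrow> 'a poly \<Rightarrow> 'a poly \<Rightarrow> 'a poly \<Rightarrow> 'a mat \<Rightarrow> 'a" where
  "piece_point a \<mu> \<eta> w = cone_point (monom 1 a * \<mu>)
     (monom 1 (m - a) * w - monom 1 (n - m - a) * (\<mu> * (\<eta> * \<eta>))) (\<mu> * \<eta>)"

definition piece :: "nat \<Rightarrow> ('a mat \<Rightarrow> 'a) set" where
  "piece a = {piece_point a \<mu> \<eta> w |\<mu> \<eta> w. True}"

definition closed_piece :: "nat \<Rightarrow> ('a mat \<Rightarrow> 'a) set" where
  "closed_piece a = (zariski V) closure_of (piece a)"

lemma monom_split: "a \<le> b \<Longrightarrow> (monom 1 b :: 'a poly) = monom 1 a * monom 1 (b - a)"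
  by (simp add: mult_monom)

lemma piece_subset_null_cone:
  assumes "a \<le> k\<^sub>0"
  shows "piece a \<subseteq> null_cone e"
proof
  fix \<xi> assume "\<xi> \<in> piece a"
  then obtain \<mu> \<eta> w where \<xi>: "\<xi> = piece_point a \<mu> \<eta> w" by (auto simp: piece_def)
  have "monom 1 a * \<mu> * (monom 1 (m - a) * w - monom 1 (n - m - a) * (\<mu> * (\<eta> * \<eta>))) + T * (\<mu> * \<eta> * (\<mu> * \<eta>))
      = monom 1 m * (\<mu> * w)"
    using assms monom_split[of a m] monom_split[of a "n - m"] by (simp add: algebra_simps)
  then show "\<xi> \<in> null_cone e"
    unfolding null_cone_eq_cone_point \<xi> piece_point_def by (metis (mono_tags, lifting) dvd_triv_left mem_Collect_eq)
qed

lemma piece_irreducible: "irreducible_in (zariski V) (piece a)"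
proof (rule irreducible_if_curves)
  show "piece a \<subseteq> dual_space V" by (auto simp: piece_def piece_point_def cone_point_def)
  show "piece a \<noteq> {}" by (auto simp: piece_def)
  fix x y assume "x \<in> piece a" "y \<in> piece a"
  then obtain \<mu> \<eta> w \<mu>' \<eta>' w' where x: "x = piece_point a \<mu> \<eta> w" and y: "y = piece_point a \<mu>' \<eta>' w'"
    by (auto simp: piece_def)
  \<comment> \<open>The segment from \<open>p\<close> to \<open>q\<close>; joining the parameters by
    segments joins the two points inside the piece.\<close>
  let ?l = "\<lambda>p q. lift_poly p + [:[:0, 1:]:] * lift_poly (q - p)"
  have l: "specialise 0 (?l p q) = p" "specialise 1 (?l p q) = q" for p q :: "'a poly"
    by simp_all
  let ?c = "cone_curve (monom 1 a * ?l \<mu> \<mu>')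
     (monom 1 (m - a) * ?l w w' - monom 1 (n - m - a) * (?l \<mu> \<mu>' * (?l \<eta> \<eta>' * ?l \<eta> \<eta>'))) (?l \<mu> \<mu>' * ?l \<eta> \<eta>')"
  have c: "?c \<tau> = piece_point a (specialise \<tau> (?l \<mu> \<mu>')) (specialise \<tau> (?l \<eta> \<eta>')) (specialise \<tau> (?l w w'))" for \<tau>
    unfolding cone_curve_def piece_point_def by simp
  have "?c 0 = x" "?c 1 = y" unfolding c l x y by simp_all
  moreover have "?c \<tau> \<in> piece a" for \<tau> unfolding c piece_def by blast
  ultimately show "\<exists>A B C D. curve A B C D 0 = x \<and> curve A B C D 1 = y \<and> (\<forall>\<tau>. curve A B C D \<tau> \<in> piece a)"
    unfolding cone_curve_eq by blast
qed

section \<open>Incomparability of the closures\<close>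

lemma closedin_eval_eq_0:
  assumes "x \<in> V"
  shows "closedin (zariski V) {\<xi> \<in> dual_space V. \<xi> x = 0}"
  unfolding closedin_zariski
  by (rule exI[of _ "{\<lambda>\<xi>\<in>dual_space V. \<xi> x}"]) (use assms in \<open>auto intro: sym_alg_eval\<close>)

lemma closure_piece_not_subset:
  assumes "x \<in> V" "\<And>\<xi>. \<xi> \<in> piece a \<Longrightarrow> \<xi> x = 0" "\<xi> \<in> piece b" "\<xi> x \<noteq> 0"
  shows "\<not> closed_piece b \<subseteq> closed_piece a"
proof
  have dual: "piece a \<subseteq> dual_space V" for a using piece_irreducible by (auto simp: irreducible_in_def)
  assume sub: "closed_piece b \<subseteq> closed_piece a"
  have "closed_piece a \<subseteq> {\<xi> \<in> dual_space V. \<xi> x = 0}"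
    using dual assms(2) unfolding closed_piece_def by (intro closure_of_minimal closedin_eval_eq_0 assms(1)) auto
  moreover have "\<xi> \<in> closed_piece b"
    using assms(3) closure_of_subset[of "piece b" "zariski V"] dual unfolding closed_piece_def by auto
  ultimately show False using sub assms(4) by auto
qed

text \<open>One coordinate separates two pieces in each direction: the smallest possible order of
  \<open>B\<close> grows with the index, while that of \<open>C\<close> falls.\<close>

lemma closure_piece_subset_imp_eq:
  assumes ab: "a \<le> k\<^sub>0" "b \<le> k\<^sub>0" and sub: "closed_piece a \<subseteq> closed_piece b"
  shows "a = b"
proof (rule ccontr)
  assume "a \<noteq> b"
  then consider "a < b" | "b < a" by linarith
  then show False
  proof cases
    case 1
    have "a < m" using 1 ab by simp
    then obtain x where x: "x \<in> V" and ev: "\<And>A B C D. functional A B C D x = coeff B a"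
      using coeff_functional(2) phi_in by blast
    have "\<xi> x = 0" if "\<xi> \<in> piece b" for \<xi>
      using that 1 by (auto simp: piece_def piece_point_def cone_point_def ev coeff_monom_mult)
    moreover have "piece_point a 1 0 0 x \<noteq> 0"
      by (simp add: piece_point_def cone_point_def ev)
    moreover have "piece_point a 1 0 0 \<in> piece a" by (auto simp: piece_def)
    ultimately show False using closure_piece_not_subset[OF x, of b _ a] sub by blast
  next
    case 2
    let ?i = "k\<^sub>0 - a"
    have "?i < m" using 2 ab m_pos by linarith
    then obtain x where x: "x \<in> V" and ev: "\<And>A B C D. functional A B C D x = coeff C ?i"
      using coeff_functional(3) phi_in by blast
    \<comment> \<open>Both terms of \<open>C\<close> on piece \<open>b\<close> have order above
      \<open>?i\<close>; on piece \<open>a\<close> the term with the smaller exponent reaches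
      \<open>?i\<close>, whence the case split below.\<close>
    have i: "?i < m - b" "?i < n - m - b" using 2 ab by auto
    have "\<xi> x = 0" if "\<xi> \<in> piece b" for \<xi>
      using that i by (auto simp: piece_def piece_point_def cone_point_def ev coeff_monom_mult)
    moreover have "\<exists>\<eta> w. piece_point a 1 \<eta> w x \<noteq> 0"
    proof (cases "n - m < m")
      case True
      then show ?thesis
        by (intro exI[of _ 1] exI[of _ 0]) (simp add: piece_point_def cone_point_def ev)
    next
      case False
      then show ?thesis
        by (intro exI[of _ 0] exI[of _ 1]) (simp add: piece_point_def cone_point_def ev)
    qed
    moreover have "piece_point a 1 \<eta> w \<in> piece a" for \<eta> w by (auto simp: piece_def)
    ultimately show False using closure_piece_not_subset[OF x, of b _ a] sub by blast
  qed
qed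

text \<open>After \<open>t^p\<close> is cancelled, the equation says that
  \<open>\<mu> C + t^(n-m-p) D^2\<close> is \<open>t^(m-p) q\<close> for some \<open>q\<close>.
  Dividing by the unit \<mu> recovers the parameters of the piece.\<close>

lemma cone_point_in_piece:
  assumes dvd: "monom 1 m dvd B * C + T * (D * D)" and B: "monom 1 m dvd B - monom 1 p * \<mu>"
    and \<mu>: "coeff \<mu> 0 \<noteq> 0" and p: "p \<le> k\<^sub>0"
  shows "cone_point B C D \<in> piece p"
proof -
  obtain \<nu> where \<nu>: "monom 1 m dvd \<nu> * \<mu> - 1" using poly_inverse_mod_monom[OF \<mu>] by blast
  have "monom 1 m dvd (B * C + T * (D * D)) - (B - monom 1 p * \<mu>) * C"
    by (rule dvd_diff[OF dvd dvd_mult2[OF B]])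
  also have "\<dots> = monom 1 p * (\<mu> * C + monom 1 (n - m - p) * (D * D))"
    using p monom_split[of p "n - m"] by (simp add: algebra_simps)
  finally have "monom 1 p * monom 1 (m - p) dvd monom 1 p * (\<mu> * C + monom 1 (n - m - p) * (D * D))"
    using p monom_split[of p m] by simp
  then have "monom 1 (m - p) dvd \<mu> * C + monom 1 (n - m - p) * (D * D)"
    by (subst (asm) dvd_mult_cancel_left) (simp add: monom_eq_0_iff)
  then obtain q where q: "\<mu> * C + monom 1 (n - m - p) * (D * D) = monom 1 (m - p) * q" by (elim dvdE)
  have "cone_point B C D = piece_point p \<mu> (\<nu> * D) (\<nu> * q)"
    unfolding piece_point_def
  proof (rule cone_point_cong)
    show "monom 1 m dvd B - monom 1 p * \<mu>" by (rule B)
    have "monom 1 m dvd (\<nu> * \<mu> - 1) * - D" using \<nu> by (rule dvd_mult2)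
    then show "monom 1 m dvd D - \<mu> * (\<nu> * D)" by (simp add: algebra_simps)
    have "monom 1 m dvd (\<nu> * \<mu> - 1) * (monom 1 (n - m - p) * (\<nu> * (D * D)) - C)" using \<nu> by (rule dvd_mult2)
    also have "\<dots> = C - (\<nu> * (monom 1 (m - p) * q) - monom 1 (n - m - p) * (\<mu> * (\<nu> * D * (\<nu> * D))))"
      unfolding q[symmetric] by (simp add: algebra_simps)
    finally show "monom 1 m dvd C - (monom 1 (m - p) * (\<nu> * q) - monom 1 (n - m - p) * (\<mu> * (\<nu> * D * (\<nu> * D))))"
      by (simp add: mult_ac)
  qed
  then show ?thesis by (auto simp: piece_def)
qed

lemma cone_curve_limit:
  assumes "closedin (zariski V) S" "finite E" "\<And>\<tau>. \<tau> \<notin> E \<Longrightarrow> cone_curve B C D \<tau> \<in> S"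
  shows "cone_curve B C D \<tau> \<in> S"
  unfolding cone_curve_eq
proof (rule curve_in_closed[OF assms(1)])
  have "UNIV = E \<union> {\<tau>. cone_curve B C D \<tau> \<in> S}" using assms(3) by auto
  then show "infinite {\<tau>. curve (- (monom 1 (n - m) * D)) B C D \<tau> \<in> S}"
    using assms(2) infinite_UNIV_char_0[where ?'a = 'a] unfolding cone_curve_eq by (metis finite_UnI)
qed

end

section \<open>The closures cover the null-cone\<close>

locale jordan_pair_alg_closed = jordan_pair e n m \<Phi>
  for e :: "'a::{alg_closed_field, field_char_0} mat" and n m \<Phi>
begin

definition pieces :: "('a mat \<Rightarrow> 'a) set" where
  "pieces = (\<Union>a\<in>{..k\<^sub>0}. closed_piece a)"

lemma closedin_pieces: "closedin (zariski V) pieces"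
  unfolding pieces_def closed_piece_def by (intro closedin_Union) auto

lemma piece_subset_pieces: "a \<le> k\<^sub>0 \<Longrightarrow> piece a \<subseteq> pieces"
proof -
  assume a: "a \<le> k\<^sub>0"
  have "piece a \<subseteq> closed_piece a"
    using piece_irreducible[of a] by (simp add: closed_piece_def irreducible_in_def closure_of_subset)
  then show ?thesis using a by (auto simp: pieces_def)
qed

text \<open>If \<open>C\<close> is a unit, the equation gives \<open>B = - T D^2 / C\<close>. Adding
  a constant \<tau> to \<open>D\<close> makes \<open>D\<close> a unit for almost all \<tau>, so that
  \<open>B\<close> has order exactly \<open>n - m\<close> and the point lies in a piece; then let
  \<tau> tend to 0.\<close>

lemma cone_point_in_pieces_if_unit:
  assumes r: "n - m < m" and dvd: "monom 1 m dvd B * C + T * (D * D)" and C: "coeff C 0 \<noteq> 0"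
  shows "cone_point B C D \<in> pieces"
proof -
  obtain \<nu> where \<nu>: "monom 1 m dvd \<nu> * C - 1" using poly_inverse_mod_monom[OF C] by blast
  have "coeff (\<nu> * C) 0 = 1" using coeff_eq_if_dvd_diff[OF \<nu>, of 0] m_pos by simp
  then have \<nu>0: "coeff \<nu> 0 \<noteq> 0" by (auto simp: coeff_mult)
  let ?D = "lift_poly D + [:[:0, 1:]:]"
  let ?c = "cone_curve (- (monom 1 (n - m) * (?D * ?D * lift_poly \<nu>))) (lift_poly C) ?D"
  have c: "?c \<tau> = cone_point (T * - ((D + [:\<tau>:]) * (D + [:\<tau>:]) * \<nu>)) C (D + [:\<tau>:])" for \<tau>
    by (simp add: cone_curve_def)
  have "?c 0 \<in> pieces"
  proof (rule cone_curve_limit[OF closedin_pieces])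
    show "finite {- coeff D 0}" by simp
    fix \<tau> assume "\<tau> \<notin> {- coeff D 0}"
    then have D0: "coeff (D + [:\<tau>:]) 0 \<noteq> 0" by (auto simp: add_eq_0_iff)
    have "?c \<tau> \<in> piece (n - m)" unfolding c
    proof (rule cone_point_in_piece)
      show "monom 1 m dvd T * - ((D + [:\<tau>:]) * (D + [:\<tau>:]) * \<nu>) - T * - ((D + [:\<tau>:]) * (D + [:\<tau>:]) * \<nu>)" by simp
      have "monom 1 m dvd (\<nu> * C - 1) * - (T * ((D + [:\<tau>:]) * (D + [:\<tau>:])))" using \<nu> by (rule dvd_mult2)
      also have "\<dots> = T * - ((D + [:\<tau>:]) * (D + [:\<tau>:]) * \<nu>) * C + T * ((D + [:\<tau>:]) * (D + [:\<tau>:]))"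
        by (simp only: left_diff_distrib mult_minus_right mult_minus_left mult_ac mult_1_left) simp
      finally show "monom 1 m dvd \<dots>" .
      show "coeff (- ((D + [:\<tau>:]) * (D + [:\<tau>:]) * \<nu>)) 0 \<noteq> 0" using D0 \<nu>0 by (simp add: coeff_mult)
      show "n - m \<le> k\<^sub>0" using r by simp
    qed
    then show "?c \<tau> \<in> pieces" using piece_subset_pieces[of "n - m"] r by auto
  qed
  moreover have "?c 0 = cone_point B C D"
    unfolding c
  proof (rule cone_point_cong)
    have "monom 1 m dvd (\<nu> * C - 1) * B - \<nu> * (B * C + T * (D * D))"
      by (rule dvd_diff[OF dvd_mult2[OF \<nu>] dvd_mult[OF dvd]])
    also have "\<dots> = T * - ((D + [:0:]) * (D + [:0:]) * \<nu>) - B" by (simp add: algebra_simps)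
    finally show "monom 1 m dvd \<dots>" .
  qed simp_all
  ultimately show ?thesis by simp
qed

text \<open>The curves below replace the factor \<open>t\<^sup>p\<close> of \<open>B\<close> by \<open>t\<^sup>p\<^sup>-\<^sup>1(t - \<tau>\<^sup>2)\<close>. Solving for \<open>C\<close> needs
  \<open>t\<^sup>r D\<^sup>2 - t\<^sup>m h\<close> to vanish at \<open>t = \<tau>\<^sup>2\<close>, which is arranged by adding a constant to the cofactor of
  \<open>D\<close>; the parameter is \<open>\<tau>\<^sup>2\<close> so that the required square root of \<open>\<tau>\<^sup>2\<^sup>q h(0)\<close> is polynomial in \<open>\<tau>\<close>.\<close>

lemma cone_point_descent:
  assumes IH: "\<And>B C D \<mu>. monom 1 m dvd B * C + T * (D * D) \<Longrightarrow> monom 1 m dvd B - monom 1 (p - 1) * \<mu> \<Longrightarrow>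
      coeff \<mu> 0 \<noteq> 0 \<Longrightarrow> cone_point B C D \<in> pieces"
    and dvd: "monom 1 m dvd B * C + T * (D * D)" and B: "monom 1 m dvd B - monom 1 p * \<mu>"
    and \<mu>0: "coeff \<mu> 0 \<noteq> 0" and p: "n - m < p" "p < m" and C0: "coeff C 0 = 0"
  shows "cone_point B C D \<in> pieces"
proof -
  obtain \<nu> where \<nu>: "monom 1 m dvd \<nu> * \<mu> - 1" using poly_inverse_mod_monom[OF \<mu>0] by blast
  have "monom 1 m dvd (B * C + T * (D * D)) - (B - monom 1 p * \<mu>) * C"
    by (rule dvd_diff[OF dvd dvd_mult2[OF B]])
  then obtain h where h: "monom 1 p * \<mu> * C + T * (D * D) = monom 1 m * h"
    by (auto simp: algebra_simps elim!: dvdE)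
  \<comment> \<open>\<open>t^j\<close> is the power split off from \<open>D\<close>, and \<epsilon>,
    which is 0 or 1, is the exponent of \<open>t\<close> left when \<open>t^(n-m) t^(2j)\<close> is
    divided by \<open>t^(p-1)\<close>. The exponent \<open>q\<close> balances \<epsilon> so that
    both terms of \<open>W\<close> get the same power of \<tau> at
    \<open>t = \<tau>^2\<close>.\<close>
  define s where "s = p - (n - m)"
  define j where "j = s div 2"
  define q where "q = m - (n - m) - 2 * j"
  define \<epsilon> where "\<epsilon> = n - m + 2 * j - (p - 1)"
  have s: "0 < s" "n - m + s = p" using p by (simp_all add: s_def)
  have j: "p - 1 \<le> n - m + 2 * j" "n - m + 2 * j \<le> p" using s by (auto simp: j_def)
  have q: "0 < q" "\<epsilon> + q = m - p + 1" using j p by (auto simp: q_def \<epsilon>_def)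
  have t1: "monom (1::'a) 1 dvd C" using C0 by (simp add: monom_1_dvd_iff' del: One_nat_def)
  \<comment> \<open>As \<open>C\<close> has no constant term, \<open>T D^2\<close> is divisible by
    \<open>t^(p+1)\<close>. This extra factor makes \<open>y\<close> vanish at 0, which the limit at
    \<open>\<tau> = 0\<close> requires.\<close>
  have "monom 1 (p + 1) dvd monom 1 m * h - monom 1 p * C * \<mu>"
  proof (rule dvd_diff[OF dvd_mult2 dvd_mult2])
    show "monom (1::'a) (p + 1) dvd monom 1 m" using monom_split[of "p + 1" m] p by simp
    show "monom 1 (p + 1) dvd monom 1 p * C"
      using mult_dvd_mono[OF dvd_refl t1, of "monom 1 p"] by (simp add: mult_monom)
  qed
  also have "\<dots> = T * (D * D)" using h by (simp add: algebra_simps)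
  finally have "T * monom 1 (Suc s) dvd T * (D * D)" using s by (simp add: mult_monom)
  then have "monom 1 (Suc s) dvd D * D"
    by (subst (asm) dvd_mult_cancel_left) simp
  then have "monom 1 (Suc j) dvd D" unfolding j_def by (rule monom_dvd_power2)
  then obtain y' where y': "D = monom 1 (Suc j) * y'" by (elim dvdE)
  define y where "y = monom 1 1 * y'"
  have D: "D = monom 1 j * y" and y0: "coeff y 0 = 0"
    by (simp_all add: y_def y' mult_monom coeff_monom_mult flip: mult.assoc)
  obtain g where g: "g ^ 2 = coeff h 0" using nth_root_exists[of 2 "coeff h 0"] by auto
  define \<sigma> :: "'a poly" where "\<sigma> = monom 1 2"
  \<comment> \<open>The constants enforce \<open>Y = g \<tau>^q\<close> and \<open>H = h(0)\<close>
    at \<open>t = \<tau>^2\<close>, so \<open>W\<close> vanishes there. Both corrections are zero at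
    \<open>\<tau> = 0\<close>, the first since \<open>q > 0\<close> and
    \<open>y(0) = 0\<close>.\<close>
  define Y where "Y = lift_poly y + [:monom g q - pcompose y \<sigma>:]"
  define H where "H = lift_poly h + [:[:coeff h 0:] - pcompose h \<sigma>:]"
  define W where "W = monom 1 \<epsilon> * (Y * Y) - monom 1 (m - p + 1) * H"
  have "poly W \<sigma> = \<sigma> ^ \<epsilon> * (monom g q * monom g q) - \<sigma> ^ (m - p + 1) * [:coeff h 0:]"
    by (simp add: W_def Y_def H_def poly_monom)
  also have "\<dots> = 0"
  proof -
    have "2 * \<epsilon> + (q + q) = 2 * (m - p + 1)" using q by simp
    then show ?thesis
      using g by (simp add: \<sigma>_def monom_power mult_monom power2_eq_square mult.commute[of _ "[:_:]"] smult_monom)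
  qed
  finally have "[:- \<sigma>, 1:] dvd W" by (simp add: poly_eq_0_iff_dvd)
  then obtain K where K: "W = [:- \<sigma>, 1:] * K" by (elim dvdE)
  let ?c = "cone_curve (monom 1 (p - 1) * ([:- \<sigma>, 1:] * lift_poly \<mu>)) (- (lift_poly \<nu> * K)) (monom 1 j * Y)"
  define Y\<^sub>\<tau> where "Y\<^sub>\<tau> \<tau> = specialise \<tau> Y" for \<tau>
  define H\<^sub>\<tau> where "H\<^sub>\<tau> \<tau> = specialise \<tau> H" for \<tau>
  define K\<^sub>\<tau> where "K\<^sub>\<tau> \<tau> = specialise \<tau> K" for \<tau>
  define l where "l \<tau> = [:- (\<tau> ^ 2), 1:]" for \<tau> :: 'a
  have K\<tau>: "l \<tau> * K\<^sub>\<tau> \<tau> = monom 1 \<epsilon> * (Y\<^sub>\<tau> \<tau> * Y\<^sub>\<tau> \<tau>) - monom 1 (m - p + 1) * H\<^sub>\<tau> \<tau>" for \<tau>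
    using arg_cong[OF K, of "specialise \<tau>"]
    by (simp only: W_def specialise_hom specialise_pCons Y\<^sub>\<tau>_def H\<^sub>\<tau>_def K\<^sub>\<tau>_def l_def) (simp add: \<sigma>_def poly_monom)
  have c: "?c \<tau> = cone_point (monom 1 (p - 1) * (l \<tau> * \<mu>)) (- (\<nu> * K\<^sub>\<tau> \<tau>)) (monom 1 j * Y\<^sub>\<tau> \<tau>)" for \<tau>
    unfolding cone_curve_def specialise_hom Y\<^sub>\<tau>_def K\<^sub>\<tau>_def l_def by (simp add: \<sigma>_def poly_monom)
  have m1: "monom 1 (p - 1) * monom 1 \<epsilon> = T * (monom 1 j * monom (1::'a) j)"
    using j by (simp add: mult_monom \<epsilon>_def mult_2)
  have m2: "monom 1 (p - 1) * monom 1 (m - p + 1) = monom (1::'a) m" using p by (simp add: mult_monom)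
  have lift: "monom 1 (p - 1) * (l \<tau> * K\<^sub>\<tau> \<tau>) = T * ((monom 1 j * Y\<^sub>\<tau> \<tau>) * (monom 1 j * Y\<^sub>\<tau> \<tau>)) - monom 1 m * H\<^sub>\<tau> \<tau>" for \<tau>
    unfolding K\<tau> right_diff_distrib mult.assoc[symmetric] m1 m2 by (simp only: mult_ac)
  have "?c 0 \<in> pieces"
  proof (rule cone_curve_limit[OF closedin_pieces])
    show "finite {0::'a}" by simp
    fix \<tau> :: 'a assume \<tau>: "\<tau> \<notin> {0}"
    show "?c \<tau> \<in> pieces" unfolding c
    proof (rule IH)
      have "monom 1 m dvd (\<nu> * \<mu> - 1) * - (monom 1 (p - 1) * (l \<tau> * K\<^sub>\<tau> \<tau>)) + monom 1 m * H\<^sub>\<tau> \<tau>"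
        by (rule dvd_add[OF dvd_mult2[OF \<nu>] dvd_triv_left])
      also have "\<dots> = - (\<nu> * \<mu>) * (monom 1 (p - 1) * (l \<tau> * K\<^sub>\<tau> \<tau>)) + (monom 1 (p - 1) * (l \<tau> * K\<^sub>\<tau> \<tau>) + monom 1 m * H\<^sub>\<tau> \<tau>)"
        by (simp only: left_diff_distrib mult_minus_right mult_minus_left mult_1_left) simp
      also have "monom 1 (p - 1) * (l \<tau> * K\<^sub>\<tau> \<tau>) + monom 1 m * H\<^sub>\<tau> \<tau> = T * ((monom 1 j * Y\<^sub>\<tau> \<tau>) * (monom 1 j * Y\<^sub>\<tau> \<tau>))"
        unfolding lift by simp
      finally show "monom 1 m dvd monom 1 (p - 1) * (l \<tau> * \<mu>) * - (\<nu> * K\<^sub>\<tau> \<tau>) + T * (monom 1 j * Y\<^sub>\<tau> \<tau> * (monom 1 j * Y\<^sub>\<tau> \<tau>))"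
        by (simp only: mult_minus_right mult_minus_left mult_ac)
      \<comment> \<open>The constant term is \<open>- \<tau>^2 \<mu>(0)\<close>: away from
        \<open>\<tau> = 0\<close> the order of \<open>B\<close> has dropped to
        \<open>p - 1\<close>.\<close>
      show "coeff (l \<tau> * \<mu>) 0 \<noteq> 0" using \<tau> \<mu>0 by (simp add: l_def coeff_mult)
    qed simp
  qed
  moreover have "?c 0 = cone_point B C D"
    unfolding c
  proof (rule cone_point_cong)
    have Y0: "Y\<^sub>\<tau> 0 = y" using y0 q(1) by (simp add: Y\<^sub>\<tau>_def Y_def \<sigma>_def poly_monom poly_pcompose poly_0_coeff_0)
    have H0: "H\<^sub>\<tau> 0 = h" by (simp add: H\<^sub>\<tau>_def H_def \<sigma>_def poly_monom poly_pcompose poly_0_coeff_0)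
    have l0: "l 0 = monom 1 1" by (simp add: l_def monom_Suc monom_0)
    have p1: "monom 1 (p - 1) * l 0 = monom (1::'a) p" using p unfolding l0 by (simp add: mult_monom)
    show "monom 1 m dvd monom 1 j * Y\<^sub>\<tau> 0 - D" by (simp add: Y0 D)
    show "monom 1 m dvd monom 1 (p - 1) * (l 0 * \<mu>) - B"
      using B unfolding mult.assoc[symmetric] p1 by (simp add: dvd_diff_commute)
    have "monom 1 p * K\<^sub>\<tau> 0 = T * (D * D) - monom 1 m * h"
      using lift[of 0] unfolding mult.assoc[symmetric] p1 Y0 H0 D[symmetric] by (simp add: D mult_ac)
    also have "\<dots> = monom 1 p * (- (\<mu> * C))" unfolding h[symmetric] by simp
    finally have "monom 1 p * K\<^sub>\<tau> 0 = monom 1 p * (- (\<mu> * C))" .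
    then have K0: "K\<^sub>\<tau> 0 = - (\<mu> * C)"
      by (subst (asm) mult_left_cancel) (simp_all add: monom_eq_0_iff)
    have "monom 1 m dvd (\<nu> * \<mu> - 1) * C" using \<nu> by (rule dvd_mult2)
    then show "monom 1 m dvd - (\<nu> * K\<^sub>\<tau> 0) - C" by (simp add: K0 algebra_simps)
  qed
  ultimately show ?thesis by simp
qed

text \<open>Induction on the order \<open>p\<close> of \<open>B\<close>. Orders up to
  \<open>k\<^sub>0\<close> lie in a piece, a unit \<open>C\<close> is handled directly, and
  otherwise the point is a limit of points of order \<open>p - 1\<close>.\<close>

lemma cone_point_in_pieces:
  assumes "monom 1 m dvd B * C + T * (D * D)" "monom 1 m dvd B - monom 1 p * \<mu>" "coeff \<mu> 0 \<noteq> 0" "p \<le> m"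
  shows "cone_point B C D \<in> pieces"
  using assms
proof (induction p arbitrary: B C D \<mu> rule: less_induct)
  case (less p)
  consider "p \<le> k\<^sub>0" | "n - m < p" "n - m < m" "coeff C 0 \<noteq> 0" | "n - m < p" "p = m" "coeff C 0 = 0"
    | "n - m < p" "p < m" "coeff C 0 = 0"
    using less.prems(4) by linarith
  then show ?case
  proof cases
    case 1
    then show ?thesis using cone_point_in_piece[OF less.prems(1-3)] piece_subset_pieces by blast
  next
    case 2
    then show ?thesis using cone_point_in_pieces_if_unit less.prems(1) by blast
  next
    case 3
    have Bm: "monom 1 m dvd B"
      using less.prems(2) dvd_add[OF less.prems(2) dvd_triv_left[of "monom 1 p" \<mu>, unfolded 3(2)]] 3(2) by simp
    have "monom 1 m dvd (B * C + T * (D * D)) - B * C"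
      by (rule dvd_diff[OF less.prems(1) dvd_mult2[OF Bm]])
    then have TD: "monom 1 m dvd T * (D * D)" by simp
    have t1: "monom (1::'a) 1 dvd C" using 3(3) by (simp add: monom_1_dvd_iff' del: One_nat_def)
    have "monom (1::'a) (m - 1) * monom 1 1 dvd monom 1 (m - 1) * C" using t1 by (intro mult_dvd_mono) auto
    then have tC: "monom 1 m dvd monom 1 (m - 1) * C" using m_pos by (simp add: mult_monom)
    \<comment> \<open>Here \<open>B\<close> is zero modulo \<open>t^m\<close>; it is deformed to
      \<open>\<tau> t^(m-1)\<close>. The equation survives because \<open>t\<close> divides
      \<open>C\<close>.\<close>
    let ?c = "cone_curve (monom [:0, 1:] (m - 1)) (lift_poly C) (lift_poly D)"
    have c: "?c \<tau> = cone_point (monom 1 (m - 1) * [:\<tau>:]) C D" for \<tau>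
      by (simp add: cone_curve_def smult_monom)
    have "?c 0 \<in> pieces"
    proof (rule cone_curve_limit[OF closedin_pieces])
      show "finite {0::'a}" by simp
      fix \<tau> :: 'a assume "\<tau> \<notin> {0}"
      moreover have "monom 1 m dvd monom 1 (m - 1) * C * [:\<tau>:] + T * (D * D)"
        by (rule dvd_add[OF dvd_mult2[OF tC] TD])
      then have "monom 1 m dvd monom 1 (m - 1) * [:\<tau>:] * C + T * (D * D)"
        by (simp only: mult_ac)
      ultimately show "?c \<tau> \<in> pieces"
        unfolding c using m_pos 3(2) by (intro less.IH[of "m - 1" _ _ _ "[:\<tau>:]"]) auto
    qed
    also have "?c 0 = cone_point B C D"
      unfolding c by (rule cone_point_cong) (use Bm in auto)
    finally show ?thesis .
  next
    case 4
    show ?thesis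
    proof (rule cone_point_descent[OF _ less.prems(1-3) 4])
      show "cone_point B C D \<in> pieces"
        if "monom 1 m dvd B * C + T * (D * D)" "monom 1 m dvd B - monom 1 (p - 1) * \<mu>" "coeff \<mu> 0 \<noteq> 0" for B C D \<mu>
        using less.IH[of "p - 1", OF _ that] 4 by simp
    qed
  qed
qed

lemma null_cone_eq_pieces: "null_cone e = pieces"
proof
  have "closed_piece a \<subseteq> null_cone e" if "a \<le> k\<^sub>0" for a
    unfolding closed_piece_def by (intro closure_of_minimal piece_subset_null_cone closedin_null_cone that)
  then show "pieces \<subseteq> null_cone e" unfolding pieces_def by (intro UN_least) simp
  show "null_cone e \<subseteq> pieces"
  proof
    fix \<xi> assume "\<xi> \<in> null_cone e"
    then obtain B C D where \<xi>: "\<xi> = cone_point B C D" "monom 1 m dvd B * C + T * (D * D)"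
      unfolding null_cone_eq_cone_point by blast
    obtain p \<mu> where "p \<le> m" "coeff \<mu> 0 \<noteq> 0" "monom 1 m dvd B - monom 1 p * \<mu>" by (rule monom_factor_mod)
    then show "\<xi> \<in> pieces" using \<xi> cone_point_in_pieces by blast
  qed
qed

lemma card_irreducible_components_null_cone:
  "card (irreducible_components (zariski V) (null_cone e)) = k\<^sub>0 + 1"
proof -
  have inj: "closed_piece a \<subseteq> closed_piece b \<Longrightarrow> a = b" if "a \<in> {..k\<^sub>0}" "b \<in> {..k\<^sub>0}" for a b
    using closure_piece_subset_imp_eq that by simp
  have "irreducible_components (zariski V) (null_cone e) = closed_piece ` {..k\<^sub>0}"
    unfolding null_cone_eq_pieces pieces_def
    by (rule irreducible_components_UN)
      (use inj in \<open>auto simp: closed_piece_def intro: irreducible_in_closure_of piece_irreducible\<close>)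
  moreover have "inj_on closed_piece {..k\<^sub>0}" by (rule inj_onI) (use inj in auto)
  ultimately show ?thesis by (simp add: card_image)
qed

end

section \<open>Transport from the Jordan matrix to its conjugates\<close>

lemma jordan_pair_alg_closed_if_jordan_nf:
  fixes e :: "'a::{alg_closed_field, field_char_0} mat"
  assumes nm: "m \<le> n" and jnf: "jordan_nf e [(n, 0), (m, 0)]"
  shows "\<exists>\<Phi>. jordan_pair_alg_closed e n m \<Phi>"
proof -
  let ?J = "jordan_matrix [(n, 0), (m, 0)] :: 'a mat"
  let ?c = "carrier_mat (n + m) (n + m) :: 'a mat set"
  \<comment> \<open>\<open>jordan_nf\<close> excludes blocks of size 0.\<close>
  have m: "0 < m" and sim: "similar_mat e ?J" using jnf by (auto simp: jordan_nf_def)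
  obtain N P Q where N: "{e, ?J, P, Q} \<subseteq> carrier_mat N N" and PQN: "P * Q = 1\<^sub>m N" "Q * P = 1\<^sub>m N"
    and eP: "e = P * ?J * Q"
    using similar_matD[OF sim] by blast
  have J: "?J \<in> ?c" using jordan_matrix_carrier[of "[(n, 0), (m, 0)]"] by simp
  then have NN: "N = n + m" using N by auto
  have e: "e \<in> ?c" and P: "P \<in> ?c" and Q: "Q \<in> ?c" using N NN by auto
  have PQ: "P * Q = 1\<^sub>m (n + m)" and QP: "Q * P = 1\<^sub>m (n + m)" using PQN NN by auto
  note assoc = assoc_mult_mat[of _ "n + m" "n + m" _ "n + m" _ "n + m"]
  have conj_mult: "(P * X * Q) * (P * Y * Q) = P * (X * Y) * Q" if "X \<in> ?c" "Y \<in> ?c" for X Y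
  proof -
    have "(P * X * Q) * (P * Y * Q) = P * X * (Q * P) * Y * Q" using that P Q by (simp add: assoc)
    then show ?thesis using that P Q QP by (simp add: assoc)
  qed
  have conj_inv: "P * (Q * X * P) * Q = X" if "X \<in> ?c" for X
  proof -
    have "P * (Q * X * P) * Q = (P * Q) * X * (P * Q)" using that P Q by (simp add: assoc)
    then show ?thesis using that PQ by simp
  qed
  have inv_conj: "Q * (P * X * Q) * P = X" if "X \<in> ?c" for X
  proof -
    have "Q * (P * X * Q) * P = (Q * P) * X * (Q * P)" using that P Q by (simp add: assoc)
    then show ?thesis using that QP by simp
  qed
  \<comment> \<open>Conjugation by \<open>P\<close> carries the commutant of the Jordan matrix onto
    the centraliser of \<open>e\<close> and preserves all relations of the locale.\<close>
  let ?\<Phi> = "\<lambda>a b c d. P * toeplitz n m a b c d * Q"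
  have "jordan_pair_alg_closed e n m ?\<Phi>"
  proof unfold_locales
    show "0 < m" "m \<le> n" "e \<in> ?c" by fact+
    show "centraliser e = {?\<Phi> a b c d |a b c d. True}"
    proof (rule equalityI; rule subsetI)
      fix x assume "x \<in> centraliser e"
      then have x: "x \<in> ?c" and comm: "x * e = e * x" by (simp_all add: centraliser_iff[OF e])
      let ?y = "Q * x * P"
      have y: "?y \<in> ?c" using x P Q by auto
      have "P * (?y * ?J) * Q = P * (?J * ?y) * Q"
        using comm conj_mult[OF y J] conj_mult[OF J y] conj_inv[OF x] eP by simp
      then have "Q * (P * (?y * ?J) * Q) * P = Q * (P * (?J * ?y) * Q) * P" by simp
      then have "?y * ?J = ?J * ?y" using y J inv_conj[of "?y * ?J"] inv_conj[of "?J * ?y"] by simp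
      then obtain a b c d where "?y = toeplitz n m a b c d"
        using commute_imp_toeplitz[OF m nm y] by blast
      then have "x = ?\<Phi> a b c d" using conj_inv[OF x] by simp
      then show "x \<in> {?\<Phi> a b c d |a b c d. True}" by blast
    next
      fix x assume "x \<in> {?\<Phi> a b c d |a b c d. True}"
      then obtain a b c d where x: "x = ?\<Phi> a b c d" by blast
      have "toeplitz n m a b c d * ?J = ?J * toeplitz n m a b c d"
        unfolding jordan_matrix_eq_toeplitz toeplitz_mult[OF nm] by (simp add: mult.commute)
      then have "x * e = e * x" using x eP conj_mult J by simp
      moreover have "x \<in> ?c" unfolding x using P Q by auto
      ultimately show "x \<in> centraliser e" by (simp add: centraliser_iff[OF e])
    qed
    fix a b c d a' b' c' d' :: "'a poly" and k :: 'a
    show "?\<Phi> a b c d * ?\<Phi> a' b' c' d' = ?\<Phi> (a * a' + monom 1 (n - m) * (b * c')) (a * b' + b * d')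
        (c * a' + d * c') (monom 1 (n - m) * (c * b') + d * d')"
      by (simp add: conj_mult toeplitz_mult[OF nm])
    show "?\<Phi> a b c d + ?\<Phi> a' b' c' d' = ?\<Phi> (a + a') (b + b') (c + c') (d + d')"
      unfolding toeplitz_add[symmetric] using P Q
      by (simp add: mult_add_distrib_mat[of _ "n + m" "n + m" _ "n + m"] add_mult_distrib_mat[of _ "n + m" "n + m" _ _ "n + m"])
    show "k \<cdot>\<^sub>m ?\<Phi> a b c d = ?\<Phi> ([:k:] * a) ([:k:] * b) ([:k:] * c) ([:k:] * d)"
      unfolding toeplitz_smult[symmetric] using P Q
      by (simp add: mult_smult_distrib[of _ "n + m" "n + m" _ "n + m"] mult_smult_assoc_mat[of _ "n + m" "n + m" _ "n + m"])
    show "?\<Phi> 1 0 0 1 = 1\<^sub>m (n + m)" using P Q PQ by (simp add: toeplitz_one)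
    have "?\<Phi> a b c d = 0\<^sub>m (n + m) (n + m) \<longleftrightarrow> toeplitz n m a b c d = 0\<^sub>m (n + m) (n + m)"
    proof
      assume "?\<Phi> a b c d = 0\<^sub>m (n + m) (n + m)"
      then show "toeplitz n m a b c d = 0\<^sub>m (n + m) (n + m)"
        using inv_conj[of "toeplitz n m a b c d"] P Q by simp
    next
      assume "toeplitz n m a b c d = 0\<^sub>m (n + m) (n + m)"
      then show "?\<Phi> a b c d = 0\<^sub>m (n + m) (n + m)" using P Q by simp
    qed
    then show "?\<Phi> a b c d = 0\<^sub>m (n + m) (n + m) \<longleftrightarrow>
        monom 1 n dvd a \<and> monom 1 m dvd b \<and> monom 1 m dvd c \<and> monom 1 m dvd d"
      by (simp add: toeplitz_eq_0_iff[OF m nm])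
  qed
  then show ?thesis by blast
qed

theorem proposition21:
  fixes e :: "'a::{alg_closed_field, field_char_0} mat" and n m :: nat
  assumes "n \<ge> m"
    and "jordan_nf e [(n, 0), (m, 0)]"
  shows "card (irreducible_components (zariski (centraliser e)) (null_cone e)) = min (n - m) m + 1"
proof -
  obtain \<Phi> where "jordan_pair_alg_closed e n m \<Phi>"
    using jordan_pair_alg_closed_if_jordan_nf[OF assms] by blast
  then show ?thesis by (rule jordan_pair_alg_closed.card_irreducible_components_null_cone)
qed

end
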